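(* Fix $\alpha\in(0,1)$ and assume (Boundedness), (Density) and (Smoothness), stated in the context. Let the raw endpoints $\widetilde f_{n,\tau}$, $\tau\in\{\alpha/2,1-\alpha/2\}$, be measurable empirical pinball risk minimizers over $\mathcal F_n^{\rm SH}$, and construct the fitted endpoints by pointwise sorting. There is a constant $C$ depending only on $(\alpha,\mu_{\rm low},\mu_{\rm up},\beta,d,M,L_\beta)$ such that for every $\delta\in(0,1)$, every $n\ge n_{\rm SH}$ and $m\ge1$ satisfying $$2\mu_{\rm up}\,\epsilon_2(n,\delta/4)+\eta_m(\delta)\le2\mu_{\rm low}r_-,\qquad2\mu_{\rm up}\,\epsilon_2(n,\delta/4)+\eta_m(\delta)+s_m\le2\mu_{\rm low}r_+,$$ with probability at least $1-\delta$ over $(\mathcal D^{\rm tr}_n,\mathcal D^{\rm cal}_m)$, $$\max\Bigl\{\bigl\||\hat{\mathcal C}_\alpha(\cdot)|-|\mathcal C^\star_\alpha(\cdot)|\bigr\|_{L^2(P_X)},\ \bigl\|\mathrm{Cov}_{\hat{\mathcal C}_\alpha}(\cdot)-(1-\alpha)\bigr\|_{L^2(P_X)}\Bigr\}\le C\Bigl[n^{-\frac{\beta}{2\beta+d}}(\log n)^{3/2}+\sqrt{\tfrac{\log(4/\delta)}n}+\tfrac1m+\sqrt{\tfrac{\log(4/\delta)}m}\Bigr].$$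
   Context: Data: $P_X$ is a probability measure on $\mathcal X$, $P_{Y\mid X}$ a conditional kernel, $P_{XY}=P_X\otimes P_{Y\mid X}$; $\mathcal D^{\rm tr}_n\sim P_{XY}^{\otimes n}$ and $\mathcal D^{\rm cal}_m=\{(X_i,Y_i)\}_{i=1}^m\sim P_{XY}^{\otimes m}$ independent. $f^\star_\tau(x)=\inf\{t:P_{Y\mid X=x}((-\infty,t])\ge\tau\}$; $\mathcal C^\star_\alpha(x)=[f^\star_{\alpha/2}(x),f^\star_{1-\alpha/2}(x)]$; $|\cdot|$ of a set is Lebesgue length; $\mathrm{Cov}_C(x)=P_{Y\mid X=x}(C(x))$ for fixed data. (Boundedness) $\mathcal X=[0,1]^d$ and $Y$ takes values in $\mathcal Y=[-M,M]$, $M>0$. (Density) For every $x\in\mathcal X$, $P_{Y\mid X=x}$ has support $\mathcal Y$ and a Lebesgue density with $0<\mu_{\rm low}\le p_{Y\mid X}(y\mid x)\le\mu_{\rm up}<\infty$ for every $y\in\mathcal Y$. (Smoothness) For each $\tau\in\{\alpha/2,1-\alpha/2\}$, $f^\star_\tau\in\mathcal H^\beta(\mathcal X,L_\beta)$ for some $\beta>0$, where with $k_\beta=\lceil\beta\rceil-1$, $\mathcal H^\beta(\Omega,H)$ is the set of $f:\Omega\to\mathbb R$ with $\sum_{|\gamma|\le k_\beta}\|\partial^\gamma f\|_\infty+\sum_{|\gamma|=k_\beta}\sup_{x\ne y}\frac{|\partial^\gamma f(x)-\partial^\gamma f(y)|}{\|x-y\|_\infty^{\beta-k_\beta}}\le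 H$. Pinball loss $\rho_\tau(u)=u(\tau-\mathbf 1\{u<0\})$; empirical risk = average of $\rho_\tau(Y-f(X))$ over $\mathcal D^{\rm tr}_n$. Sparse-ReLU class. $\sigma(t)=\max(t,0)$, $\sigma_{\mathbf v}(\mathbf y)=(\sigma(y_i-v_i))_i$. For depth $L$ and widths $\mathbf p=(p_0,\dots,p_{L+1})$, $p_0=d$, $p_{L+1}=1$: $f_\theta(x)=W_Lh_L(x)$, $h_0(x)=x$, $h_\ell(x)=\sigma_{\mathbf v_\ell}(W_{\ell-1}h_{\ell-1}(x))$, $1\le\ell\le L$, $W_\ell\in\mathbb R^{p_{\ell+1}\times p_\ell}$, $\mathbf v_\ell\in\mathbb R^{p_\ell}$, $\mathbf v_0=0$. With $T_M(x)=\min\{\max(x,-M),M\}$, $\mathcal F(L,\mathbf p,s,M)$ is the set of $T_M\circ f_\theta$ with all entries of all $W_j,\mathbf v_j$ in $[-1,1]$ and at most $s$ nonzero entries in total. $\mathcal F_n^{\rm SH}=\mathcal F(L_{\rm SH}(n),\mathbf p_{\rm SH}(n),S_{\rm SH}(n),M)$ with $N_n=\lceil n^{d/(2\beta+d)}\rceil$; $L_{\rm SH}(n)=8+(\lceil\log_2n\rceil+5)(1+\lceil\log_2(d\vee\beta)\rceil)$; $\mathbf p_{\rm SH}(n)=(d,W_{\rm SH}(n),\dots,W_{\rm SH}(n),1)$ with $L_{\rm SH}(n)$ hidden entries $W_{\rm SH}(n)=6(d+\lceil\beta\rceil)N_n$; $S_{\rm SH}(n)=\lceil141(d+\beta+1)^{3+d}N_n(\lceil\log_2n\rceil+6)\rceil$.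 Training threshold $n_{\rm SH}=\lceil(\beta+1)^{2\beta+d}\vee(L_\beta+1)^{(2\beta+d)/d}e^{2\beta+d}\vee e^{3(2\beta+d)/(2\beta)}\rceil$. Endpoint radius. $C_{\rm rate},C_{\rm conf}>0$ are fixed constants depending only on $(\alpha,\mu_{\rm low},\mu_{\rm up},\beta,d,M,L_\beta)$ such that, under the three assumptions, for each $\tau\in\{\alpha/2,1-\alpha/2\}$, every $u\in(0,1)$ and $n\ge n_{\rm SH}$, with probability at least $1-u$, $\|\widetilde f_{n,\tau}-f^\star_\tau\|_{L^2(P_X)}\le C_{\rm rate}n^{-\beta/(2\beta+d)}(\log n)^{3/2}+C_{\rm conf}\sqrt{\log(1/u)/n}$ (such constants exist by another theorem of the paper). For $n\ge n_{\rm SH}$, $\epsilon_2(n,u)=\min\{2M,\;C_{\rm rate}n^{-\beta/(2\beta+d)}(\log n)^{3/2}+C_{\rm conf}\sqrt{\log(1/u)/n}\}$, and $\epsilon_2(n,u)=2M$ for $n<n_{\rm SH}$. Split CQR. Sorting: $\hat f_{n,\alpha/2}=\widetilde f_{n,\alpha/2}\wedge\widetilde f_{n,1-\alpha/2}$, $\hat f_{n,1-\alpha/2}=\widetilde f_{n,\alpha/2}\vee\widetilde f_{n,1-\alpha/2}$. Score $\widehat S(x,y)=\max\{\hat f_{n,\alpha/2}(x)-y,\,y-\hat f_{n,1-\alpha/2}(x)\}$; $\beta_m=\lceil(m+1)(1-\alpha)\rceil/m$; $\widehat Q_{\beta_m}=\inf\{t\in\mathbb R:\frac1m\sum_i\mathbf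 1\{\widehat S(X_i,Y_i)\le t\}\ge\beta_m\}$ ($\inf\varnothing=+\infty$); $\hat{\mathcal C}_\alpha(x)=\{y\in\mathbb R:\widehat S(x,y)\le\widehat Q_{\beta_m}\}$. Scales: $s_m=\beta_m-(1-\alpha)$, $\eta_m(\delta)=\sqrt{\log(4/\delta)/(2m)}$, $r_0=\alpha/(2\mu_{\rm up})$, $r_-=r_0\wedge\frac{1-\alpha}{2\mu_{\rm up}}$, $r_+=r_0$. *)

theory Defs
  imports "HOL-Probability.Probability"
begin

text \<open>
  The covariate space is the cube \<open>cbox 0 1\<close> in \<open>real ^ 'd\<close> (\<open>1\<close> is the all-ones vector), so that
  \<open>d = CARD('d)\<close>. A data set of size \<open>n\<close> is a function \<open>nat \<Rightarrow> (real ^ 'd) \<times> real\<close>, used on \<open>{..<n}\<close>.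
\<close>

abbreviation unit_cube :: "(real ^ 'd) set" where
  "unit_cube \<equiv> cbox 0 1"

definition regression_model :: "(real ^ 'd) measure \<Rightarrow> (real ^ 'd \<Rightarrow> real measure) \<Rightarrow> bool" where
  "regression_model PX K \<longleftrightarrow>
     prob_space PX \<and> sets PX = sets (restrict_space borel unit_cube) \<and>
     K \<in> PX \<rightarrow>\<^sub>M prob_algebra borel"

definition joint_law ::
    "(real ^ 'd) measure \<Rightarrow> (real ^ 'd \<Rightarrow> real measure) \<Rightarrow> ((real ^ 'd) \<times> real) measure" where
  "joint_law PX K = Giry_Monad.bind PX (\<lambda>x. distr (K x) (PX \<Otimes>\<^sub>M borel) (\<lambda>y. (x, y)))"

definition sample_law ::
    "(real ^ 'd) measure \<Rightarrow> (real ^ 'd \<Rightarrow> real measure) \<Rightarrow> nat \<Rightarrow> (nat \<Rightarrow> (real ^ 'd) \<times> real) measure" where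
  "sample_law PX K n = PiM {..<n} (\<lambda>_. joint_law PX K)"

definition cond_quantile :: "('a \<Rightarrow> real measure) \<Rightarrow> real \<Rightarrow> 'a \<Rightarrow> real" where
  "cond_quantile K \<tau> x = Inf {t. measure (K x) {..t} \<ge> \<tau>}"

definition oracle_interval :: "('a \<Rightarrow> real measure) \<Rightarrow> real \<Rightarrow> 'a \<Rightarrow> real set" where
  "oracle_interval K \<alpha> x = {cond_quantile K (\<alpha> / 2) x .. cond_quantile K (1 - \<alpha> / 2) x}"

definition coverage :: "('a \<Rightarrow> real measure) \<Rightarrow> ('a \<Rightarrow> real set) \<Rightarrow> 'a \<Rightarrow> real" where
  "coverage K C x = measure (K x) (C x)"

definition bounded_response :: "(real ^ 'd \<Rightarrow> real measure) \<Rightarrow> real \<Rightarrow> bool" where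
  "bounded_response K M \<longleftrightarrow> 0 < M \<and> (\<forall>x\<in>unit_cube. measure (K x) {-M..M} = 1)"

definition measure_support :: "'a::topological_space measure \<Rightarrow> 'a set" where
  "measure_support \<mu> = {y. \<forall>U. open U \<and> y \<in> U \<longrightarrow> 0 < emeasure \<mu> U}"

definition bounded_density :: "(real ^ 'd \<Rightarrow> real measure) \<Rightarrow> real \<Rightarrow> real \<Rightarrow> real \<Rightarrow> bool" where
  "bounded_density K M \<mu>low \<mu>up \<longleftrightarrow> 0 < \<mu>low \<and>
     (\<forall>x\<in>unit_cube. measure_support (K x) = {-M..M} \<and>
        (\<exists>p :: real \<Rightarrow> real. p \<in> borel_measurable borel \<and> K x = density lborel (\<lambda>y. ennreal (p y)) \<and>
           (\<forall>y\<in>{-M..M}. \<mu>low \<le> p y \<and> p y \<le> \<mu>up)))"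

text \<open>
  In the Hoelder class, \<open>D \<gamma>\<close> is the partial derivative of \<open>f\<close> with multi-index \<open>\<gamma>\<close>; derivatives are
  taken within \<open>\<Omega>\<close>, hence one-sided at the faces of the cube. On the cube the family \<open>D\<close>
  is determined by \<open>f\<close>. The norms are extended reals, so that unbounded functions are excluded.
\<close>

definition partial_derivatives ::
    "(real ^ 'd) set \<Rightarrow> nat \<Rightarrow> (real ^ 'd \<Rightarrow> real) \<Rightarrow> (('d \<Rightarrow> nat) \<Rightarrow> real ^ 'd \<Rightarrow> real) \<Rightarrow> bool" where
  "partial_derivatives \<Omega> k f D \<longleftrightarrow>
     (\<forall>x\<in>\<Omega>. D (\<lambda>_. 0) x = f x) \<and>
     (\<forall>\<gamma> i. sum \<gamma> UNIV < k \<longrightarrow>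
        (\<forall>x\<in>\<Omega>. ((\<lambda>t. D \<gamma> (x + t *\<^sub>R axis i 1)) has_real_derivative D (\<gamma>(i := Suc (\<gamma> i))) x)
                 (at 0 within {t. x + t *\<^sub>R axis i 1 \<in> \<Omega>})))"

definition holder_class :: "real \<Rightarrow> (real ^ 'd) set \<Rightarrow> real \<Rightarrow> (real ^ 'd \<Rightarrow> real) set" where
  "holder_class \<beta> \<Omega> H = {f. 0 \<le> H \<and>
     (let k = nat (\<lceil>\<beta>\<rceil> - 1) in
      \<exists>D. partial_derivatives \<Omega> k f D \<and>
        (\<Sum>\<gamma> | sum \<gamma> UNIV \<le> k. SUP x\<in>\<Omega>. ennreal \<bar>D \<gamma> x\<bar>) +
        (\<Sum>\<gamma> | sum \<gamma> UNIV = k.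
           SUP (x, y) \<in> {(x, y). x \<in> \<Omega> \<and> y \<in> \<Omega> \<and> x \<noteq> y}.
             ennreal (\<bar>D \<gamma> x - D \<gamma> y\<bar> / infnorm (x - y) powr (\<beta> - real k)))
        \<le> ennreal H)}"

definition smooth_quantiles :: "(real ^ 'd \<Rightarrow> real measure) \<Rightarrow> real \<Rightarrow> real \<Rightarrow> real \<Rightarrow> bool" where
  "smooth_quantiles K \<alpha> \<beta> L\<beta> \<longleftrightarrow> 0 < \<beta> \<and>
     (\<forall>\<tau>\<in>{\<alpha> / 2, 1 - \<alpha> / 2}. cond_quantile K \<tau> \<in> holder_class \<beta> unit_cube L\<beta>)"

definition relu :: "real \<Rightarrow> real" where
  "relu t = max t 0"

text \<open>
  Weights are \<open>W l i j\<close> (layer, row, column) with \<open>i < p (l + 1)\<close>, \<open>j < p l\<close>, and shifts \<open>v l i\<close> with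
  \<open>i < p l\<close>; entries outside these ranges are never used.
\<close>

primrec hidden_layer ::
    "(nat \<Rightarrow> nat) \<Rightarrow> (nat \<Rightarrow> nat \<Rightarrow> nat \<Rightarrow> real) \<Rightarrow> (nat \<Rightarrow> nat \<Rightarrow> real) \<Rightarrow> (nat \<Rightarrow> real) \<Rightarrow>
     nat \<Rightarrow> nat \<Rightarrow> real" where
  "hidden_layer p W v z 0 = z"
| "hidden_layer p W v z (Suc l) =
     (\<lambda>i. relu ((\<Sum>j<p l. W l i j * hidden_layer p W v z l j) - v (Suc l) i))"

text \<open>
  Coordinates of \<open>real ^ 'd\<close> are numbered \<open>0, ..., CARD('d) - 1\<close> by an arbitrary fixed bijection;
  the network class does not depend on it, as the columns of \<open>W 0\<close> can be permuted.
\<close>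

definition network ::
    "nat \<Rightarrow> (nat \<Rightarrow> nat) \<Rightarrow> (nat \<Rightarrow> nat \<Rightarrow> nat \<Rightarrow> real) \<Rightarrow> (nat \<Rightarrow> nat \<Rightarrow> real) \<Rightarrow> real ^ 'd \<Rightarrow> real" where
  "network L p W v x =
     (\<Sum>j<p L. W L 0 j * hidden_layer p W v (\<lambda>i. x $ from_nat_into UNIV i) L j)"

definition truncate_at :: "real \<Rightarrow> real \<Rightarrow> real" where
  "truncate_at M t = min (max t (- M)) M"

definition sparse_relu_class ::
    "nat \<Rightarrow> (nat \<Rightarrow> nat) \<Rightarrow> nat \<Rightarrow> real \<Rightarrow> (real ^ 'd \<Rightarrow> real) set" where
  "sparse_relu_class L p s M = {truncate_at M \<circ> network L p W v | W v.
     (\<forall>l\<le>L. \<forall>i<p (Suc l). \<forall>j<p l. \<bar>W l i j\<bar> \<le> 1) \<and>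
     (\<forall>l\<in>{1..L}. \<forall>i<p l. \<bar>v l i\<bar> \<le> 1) \<and>
     card {(l, i, j). l \<le> L \<and> i < p (Suc l) \<and> j < p l \<and> W l i j \<noteq> 0} +
     card {(l, i). l \<in> {1..L} \<and> i < p l \<and> v l i \<noteq> 0} \<le> s}"

definition N_SH :: "nat \<Rightarrow> real \<Rightarrow> nat \<Rightarrow> nat" where
  "N_SH d \<beta> n = nat \<lceil>real n powr (real d / (2 * \<beta> + real d))\<rceil>"

definition L_SH :: "nat \<Rightarrow> real \<Rightarrow> nat \<Rightarrow> nat" where
  "L_SH d \<beta> n = nat (8 + (\<lceil>log 2 (real n)\<rceil> + 5) * (1 + \<lceil>log 2 (max (real d) \<beta>)\<rceil>))"

definition W_SH :: "nat \<Rightarrow> real \<Rightarrow> nat \<Rightarrow> nat" where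
  "W_SH d \<beta> n = 6 * (d + nat \<lceil>\<beta>\<rceil>) * N_SH d \<beta> n"

definition p_SH :: "nat \<Rightarrow> real \<Rightarrow> nat \<Rightarrow> nat \<Rightarrow> nat" where
  "p_SH d \<beta> n l = (if l = 0 then d else if l \<le> L_SH d \<beta> n then W_SH d \<beta> n else 1)"

definition S_SH :: "nat \<Rightarrow> real \<Rightarrow> nat \<Rightarrow> nat" where
  "S_SH d \<beta> n = nat \<lceil>141 * (real d + \<beta> + 1) ^ (3 + d) * real (N_SH d \<beta> n) *
                      (real_of_int \<lceil>log 2 (real n)\<rceil> + 6)\<rceil>"

definition F_SH :: "real \<Rightarrow> real \<Rightarrow> nat \<Rightarrow> (real ^ 'd \<Rightarrow> real) set" where
  "F_SH \<beta> M n =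
     sparse_relu_class (L_SH CARD('d) \<beta> n) (p_SH CARD('d) \<beta> n) (S_SH CARD('d) \<beta> n) M"

definition n_SH :: "nat \<Rightarrow> real \<Rightarrow> real \<Rightarrow> nat" where
  "n_SH d \<beta> L\<beta> = nat \<lceil>max ((\<beta> + 1) powr (2 * \<beta> + real d))
     (max ((L\<beta> + 1) powr ((2 * \<beta> + real d) / real d) * exp (2 * \<beta> + real d))
          (exp (3 * (2 * \<beta> + real d) / (2 * \<beta>))))\<rceil>"

definition pinball :: "real \<Rightarrow> real \<Rightarrow> real" where
  "pinball \<tau> u = u * (\<tau> - of_bool (u < 0))"

definition empirical_risk :: "real \<Rightarrow> nat \<Rightarrow> (nat \<Rightarrow> 'a \<times> real) \<Rightarrow> ('a \<Rightarrow> real) \<Rightarrow> real" where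
  "empirical_risk \<tau> n D f = (\<Sum>i<n. pinball \<tau> (snd (D i) - f (fst (D i)))) / real n"

text \<open>
  An estimator maps a training sample to a function, jointly measurably in sample and argument.
  Minimality is required for all samples with responses in \<open>{-M..M}\<close>; other samples have
  probability zero.
\<close>

definition measurable_erm ::
    "(real ^ 'd) measure \<Rightarrow> (real ^ 'd \<Rightarrow> real measure) \<Rightarrow> real \<Rightarrow> real \<Rightarrow> nat \<Rightarrow> real \<Rightarrow>
     ((nat \<Rightarrow> (real ^ 'd) \<times> real) \<Rightarrow> real ^ 'd \<Rightarrow> real) \<Rightarrow> bool" where
  "measurable_erm PX K \<beta> M n \<tau> f \<longleftrightarrow>
     (\<lambda>(D, x). f D x) \<in> borel_measurable (sample_law PX K n \<Otimes>\<^sub>M PX) \<and>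
     (\<forall>D \<in> {..<n} \<rightarrow>\<^sub>E unit_cube \<times> {-M..M}.
        f D \<in> F_SH \<beta> M n \<and>
        (\<forall>g\<in>F_SH \<beta> M n. empirical_risk \<tau> n D (f D) \<le> empirical_risk \<tau> n D g))"

text \<open>
  The norm takes extended-real values because a prediction set may have infinite length.
\<close>

definition L2_norm :: "'a measure \<Rightarrow> ('a \<Rightarrow> ereal) \<Rightarrow> ereal" where
  "L2_norm P g = (let I = (\<integral>\<^sup>+ x. e2ennreal ((g x)\<^sup>2) \<partial>P) in
     if I = \<infinity> then \<infinity> else ereal (sqrt (enn2real I)))"

definition endpoint_rate :: "nat \<Rightarrow> real \<Rightarrow> real \<Rightarrow> real \<Rightarrow> nat \<Rightarrow> real \<Rightarrow> real" where
  "endpoint_rate d \<beta> Crate Cconf n u =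
     Crate * real n powr (- \<beta> / (2 * \<beta> + real d)) * ln (real n) powr (3 / 2) +
     Cconf * sqrt (ln (1 / u) / real n)"

definition endpoint_radius ::
    "nat \<Rightarrow> real \<Rightarrow> real \<Rightarrow> real \<Rightarrow> real \<Rightarrow> real \<Rightarrow> nat \<Rightarrow> real \<Rightarrow> real" where
  "endpoint_radius d \<beta> M L\<beta> Crate Cconf n u =
     (if n_SH d \<beta> L\<beta> \<le> n then min (2 * M) (endpoint_rate d \<beta> Crate Cconf n u) else 2 * M)"

definition sort_lower :: "('a \<Rightarrow> real) \<Rightarrow> ('a \<Rightarrow> real) \<Rightarrow> 'a \<Rightarrow> real" where
  "sort_lower f g x = min (f x) (g x)"

definition sort_upper :: "('a \<Rightarrow> real) \<Rightarrow> ('a \<Rightarrow> real) \<Rightarrow> 'a \<Rightarrow> real" where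
  "sort_upper f g x = max (f x) (g x)"

definition score :: "('a \<Rightarrow> real) \<Rightarrow> ('a \<Rightarrow> real) \<Rightarrow> 'a \<Rightarrow> real \<Rightarrow> real" where
  "score lo hi x y = max (lo x - y) (y - hi x)"

definition conformal_level :: "real \<Rightarrow> nat \<Rightarrow> real" where
  "conformal_level \<alpha> m = real_of_int \<lceil>(real m + 1) * (1 - \<alpha>)\<rceil> / real m"

definition conformal_quantile ::
    "real \<Rightarrow> ('a \<Rightarrow> real) \<Rightarrow> ('a \<Rightarrow> real) \<Rightarrow> nat \<Rightarrow> (nat \<Rightarrow> 'a \<times> real) \<Rightarrow> ereal" where
  "conformal_quantile \<alpha> lo hi m D =
     Inf (ereal ` {t. (\<Sum>i<m. of_bool (score lo hi (fst (D i)) (snd (D i)) \<le> t)) / real m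
                      \<ge> conformal_level \<alpha> m})"

definition cqr_set ::
    "real \<Rightarrow> ('a \<Rightarrow> real) \<Rightarrow> ('a \<Rightarrow> real) \<Rightarrow> nat \<Rightarrow> (nat \<Rightarrow> 'a \<times> real) \<Rightarrow> 'a \<Rightarrow> real set" where
  "cqr_set \<alpha> lo hi m D x = {y. ereal (score lo hi x y) \<le> conformal_quantile \<alpha> lo hi m D}"

text \<open>
  The split CQR set computed from the raw endpoints \<open>flo\<close>, \<open>fhi\<close> (levels \<open>\<alpha> / 2\<close> and \<open>1 - \<alpha> / 2\<close>),
  the training sample \<open>Dtr\<close> and the calibration sample \<open>Dcal\<close>.
\<close>

definition split_cqr ::
    "real \<Rightarrow> ('s \<Rightarrow> 'a \<Rightarrow> real) \<Rightarrow> ('s \<Rightarrow> 'a \<Rightarrow> real) \<Rightarrow> nat \<Rightarrow> 's \<Rightarrow> (nat \<Rightarrow> 'a \<times> real) \<Rightarrow> 'a \<Rightarrow> real set" where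
  "split_cqr \<alpha> flo fhi m Dtr Dcal =
     cqr_set \<alpha> (sort_lower (flo Dtr) (fhi Dtr)) (sort_upper (flo Dtr) (fhi Dtr)) m Dcal"

definition length_error ::
    "(real ^ 'd) measure \<Rightarrow> (real ^ 'd \<Rightarrow> real set) \<Rightarrow> (real ^ 'd \<Rightarrow> real set) \<Rightarrow> ereal" where
  "length_error PX C C' =
     L2_norm PX (\<lambda>x. enn2ereal (emeasure lborel (C x)) - enn2ereal (emeasure lborel (C' x)))"

definition coverage_error ::
    "(real ^ 'd) measure \<Rightarrow> (real ^ 'd \<Rightarrow> real measure) \<Rightarrow> real \<Rightarrow> (real ^ 'd \<Rightarrow> real set) \<Rightarrow> ereal" where
  "coverage_error PX K \<alpha> C = L2_norm PX (\<lambda>x. ereal (coverage K C x - (1 - \<alpha>)))"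

definition s_scale :: "real \<Rightarrow> nat \<Rightarrow> real" where
  "s_scale \<alpha> m = conformal_level \<alpha> m - (1 - \<alpha>)"

definition eta_scale :: "nat \<Rightarrow> real \<Rightarrow> real" where
  "eta_scale m \<delta> = sqrt (ln (4 / \<delta>) / (2 * real m))"

definition r_zero :: "real \<Rightarrow> real \<Rightarrow> real" where
  "r_zero \<alpha> \<mu>up = \<alpha> / (2 * \<mu>up)"

definition r_minus :: "real \<Rightarrow> real \<Rightarrow> real" where
  "r_minus \<alpha> \<mu>up = min (r_zero \<alpha> \<mu>up) ((1 - \<alpha>) / (2 * \<mu>up))"

definition r_plus :: "real \<Rightarrow> real \<Rightarrow> real" where
  "r_plus \<alpha> \<mu>up = r_zero \<alpha> \<mu>up"

end

theory Submission
  imports Defs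
begin

text \<open>
  The split CQR set is the interval between the fitted endpoints, widened on both sides by the
  conformal quantile \<open>q\<close>, whereas the oracle interval is the one between the conditional quantiles
  and corresponds to \<open>q = 0\<close>. Moving the two ends of an interval changes its length by at most the sum
  of the two displacements, and its conditional probability by at most \<open>\<mu>up\<close> times that sum. So
  both errors are controlled by the \<open>L2\<close> errors of the endpoints, which are given, and by \<open>\<bar>q\<bar>\<close>.

  To bound \<open>q\<close>, write \<open>\<epsilon>\<close> for the endpoint rate. The score distribution function of the oracle
  endpoints equals \<open>1 - \<alpha>\<close> at zero, and since the density is at least \<open>\<mu>low\<close>, moving away from zero by
  \<open>r\<close> changes it by at least \<open>2 * \<mu>low * r\<close>, as long as the moved ends stay inside \<open>{-M..M}\<close> and do not
  cross; this is what \<open>r_minus\<close> and \<open>r_plus\<close> guarantee (\<open>prob_widened\<close>, \<open>prob_narrowed\<close>).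
  Replacing the oracle endpoints by the fitted ones costs at most \<open>2 * \<mu>up * \<epsilon>\<close> after integration over the
  covariate (\<open>score_cdf_widened\<close>, \<open>score_cdf_narrowed\<close>). The empirical frequency of the score
  deviates from its distribution function by at most \<open>\<eta> = eta_scale m \<delta>\<close>, so its crossing of the
  level \<open>1 - \<alpha> + s\<close>, where \<open>s = s_scale \<alpha> m\<close>, happens where \<open>2 * \<mu>low * \<bar>q\<bar> \<le> 2 * \<mu>up * \<epsilon> + \<eta> + s\<close>.
  Only the frequencies at the two ends of this window matter, so Hoeffding's inequality at two points
  replaces a uniform bound (\<open>calibration\<close>).

  The two endpoint events and the two Hoeffding events each fail with probability at most \<open>\<delta> / 4\<close>, the
  latter conditionally on the training sample; Fubini's theorem combines them
  (\<open>prob_pair_lower_bound\<close>). This needs the final event to be measurable, because the measure of a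
  nonmeasurable set is zero by convention.
\<close>

section \<open>Response laws with a density bounded above and below\<close>

text \<open>
  The density enters only through the two bounds that it gives for probabilities of intervals, the lower
  one inside \<open>{-M..M}\<close> only.
\<close>

locale bounded_density_law = real_distribution P for P :: "real measure" +
  fixes M \<mu>low \<mu>up :: real
  assumes M_pos: "0 < M" and low_pos: "0 < \<mu>low"
    and prob_range: "prob {-M..M} = 1"
    and prob_Icc_upper: "a \<le> b \<Longrightarrow> prob {a..b} \<le> \<mu>up * (b - a)"
    and prob_Icc_lower: "-M \<le> a \<Longrightarrow> a \<le> b \<Longrightarrow> b \<le> M \<Longrightarrow> \<mu>low * (b - a) \<le> prob {a..b}"
begin

lemma upper_range: "1 \<le> 2 * M * \<mu>up"
  using prob_Icc_upper[of "-M" M] M_pos prob_range by (simp add: algebra_simps)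

lemma up_pos: "0 < \<mu>up"
  using upper_range M_pos by (smt (verit) mult_nonneg_nonpos)

lemma low_le_up: "\<mu>low \<le> \<mu>up"
  using order_trans[OF prob_Icc_lower[of "-M" M] prob_Icc_upper[of "-M" M]] M_pos by simp

lemma prob_singleton: "prob {a} = 0"
  using prob_Icc_upper[of a a] measure_nonneg[of P "{a}"] by simp

text \<open>
  The maximum with zero covers crossed ends, where the interval is empty. Narrowing by a negative
  conformal quantile can produce such intervals.
\<close>

lemma prob_Icc_cdf: "prob {a..b} = max 0 (cdf P b - cdf P a)"
proof (cases "a \<le> b")
  case True
  have "prob ({a} \<union> {a<..b}) = prob {a} + prob {a<..b}"
    by (rule finite_measure_Union) auto
  also have "{a} \<union> {a<..b} = {a..b}" using True by auto
  finally have "prob {a..b} = prob {a} + prob {a<..b}" .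
  also have "prob {a<..b} = cdf P b - cdf P a"
    using True by (cases "a = b") (auto simp: cdf_diff_eq)
  finally show ?thesis
    using cdf_nondecreasing[OF True] prob_singleton by simp
next
  case False
  then show ?thesis using cdf_nondecreasing[of b a] by simp
qed

lemma cdf_lipschitz: "\<bar>cdf P a - cdf P b\<bar> \<le> \<mu>up * \<bar>a - b\<bar>"
proof -
  have "\<bar>cdf P a - cdf P b\<bar> \<le> \<mu>up * \<bar>a - b\<bar>" if "a \<le> b" for a b
    using prob_Icc_upper[OF that] cdf_nondecreasing[OF that] prob_Icc_cdf[of a b] that by auto
  from this[of a b] this[of b a] show ?thesis
    by (cases "a \<le> b") (auto simp: abs_minus_commute)
qed

lemma cdf_increase:
  assumes "-M \<le> a" "a \<le> b" "b \<le> M"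
  shows "\<mu>low * (b - a) \<le> cdf P b - cdf P a"
  using prob_Icc_lower[OF assms] prob_Icc_cdf[of a b] cdf_nondecreasing[OF assms(2)] by simp

lemma cdf_lower_end: "cdf P (-M) = 0" and cdf_upper_end: "cdf P M = 1"
  using prob_Icc_cdf[of "-M" M] prob_range cdf_nonneg[of "-M"] cdf_bounded_prob[of M]
  by (auto simp: max_def split: if_splits)

text \<open>
  Truncation at zero is a contraction, so the bound persists when one of the intervals is empty.
\<close>

lemma prob_Icc_perturb:
  "\<bar>prob {a..b} - prob {a'..b'}\<bar> \<le> \<mu>up * (\<bar>a - a'\<bar> + \<bar>b - b'\<bar>)"
  using cdf_lipschitz[of a a'] cdf_lipschitz[of b b']
  by (simp add: prob_Icc_cdf distrib_left)

text \<open>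
  For \<open>P = K x\<close> this is the value of \<open>cond_quantile K \<tau>\<close> at \<open>x\<close>.
\<close>

definition quantile :: "real \<Rightarrow> real" where
  "quantile \<tau> = Inf {t. \<tau> \<le> cdf P t}"

text \<open>
  The distribution function is continuous on \<open>{-M..M}\<close> and increases strictly there from 0 to 1, so it
  takes the value \<open>\<tau>\<close> at exactly one point, and the infimum is attained at that point.
\<close>

lemma
  assumes "0 < \<tau>" "\<tau> < 1"
  shows quantile_range: "-M \<le> quantile \<tau>" "quantile \<tau> \<le> M"
    and cdf_quantile: "cdf P (quantile \<tau>) = \<tau>"
    and quantile_le_iff: "quantile \<tau> \<le> t \<longleftrightarrow> \<tau> \<le> cdf P t"
proof -
  have cont: "continuous_on {-M..M} (cdf P)"
  proof (rule lipschitz_on_continuous_on)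
    show "\<mu>up-lipschitz_on {-M..M} (cdf P)"
      using cdf_lipschitz up_pos by (intro lipschitz_onI) (auto simp: dist_real_def)
  qed
  obtain q where q: "-M \<le> q" "q \<le> M" "cdf P q = \<tau>"
    using IVT'[of "cdf P" "-M" \<tau> M] cdf_lower_end cdf_upper_end assms M_pos cont by auto
  have below: "cdf P t < \<tau>" if "t < q" for t
  proof (cases "-M \<le> t")
    case True
    then show ?thesis using cdf_increase[of t q] q that low_pos by (smt (verit) mult_pos_pos)
  next
    case False
    then show ?thesis using cdf_nondecreasing[of t "-M"] cdf_lower_end assms by simp
  qed
  have *: "\<tau> \<le> cdf P t \<longleftrightarrow> q \<le> t" for t
    using below[of t] cdf_nondecreasing[of q t] q by force
  have "quantile \<tau> = q"
    unfolding quantile_def * by (simp flip: atLeast_def)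
  with q * show "-M \<le> quantile \<tau>" "quantile \<tau> \<le> M" "cdf P (quantile \<tau>) = \<tau>"
    "quantile \<tau> \<le> t \<longleftrightarrow> \<tau> \<le> cdf P t" by auto
qed

lemma
  assumes "0 < \<alpha>" "\<alpha> < 1"
  shows quantile_gap: "1 - \<alpha> \<le> \<mu>up * (quantile (1 - \<alpha> / 2) - quantile (\<alpha> / 2))"
    and quantile_mono: "quantile (\<alpha> / 2) \<le> quantile (1 - \<alpha> / 2)"
    and prob_quantiles: "prob {quantile (\<alpha> / 2)..quantile (1 - \<alpha> / 2)} = 1 - \<alpha>"
proof -
  let ?a = "quantile (\<alpha> / 2)" and ?b = "quantile (1 - \<alpha> / 2)"
  have c: "cdf P ?a = \<alpha> / 2" "cdf P ?b = 1 - \<alpha> / 2"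
    using cdf_quantile[of "\<alpha> / 2"] cdf_quantile[of "1 - \<alpha> / 2"] assms by auto
  show p: "prob {?a..?b} = 1 - \<alpha>" using c assms by (simp add: prob_Icc_cdf field_simps)
  show "?a \<le> ?b" using p assms by (cases "?a \<le> ?b") auto
  then show "1 - \<alpha> \<le> \<mu>up * (?b - ?a)" using prob_Icc_upper p by force
qed

text \<open>
  The mass below the lower quantile is \<open>\<alpha> / 2\<close> and the density is at most \<open>\<mu>up\<close>, so this quantile has
  distance at least \<open>\<alpha> / (2 * \<mu>up)\<close> from \<open>-M\<close>, and likewise the upper one from \<open>M\<close>. Within this
  distance the lower density bound applies to both added pieces.
\<close>

lemma prob_widened:
  assumes \<alpha>: "0 < \<alpha>" "\<alpha> < 1" and r: "0 \<le> r" "r \<le> \<alpha> / (2 * \<mu>up)"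
  shows "1 - \<alpha> + 2 * \<mu>low * r \<le> prob {quantile (\<alpha> / 2) - r..quantile (1 - \<alpha> / 2) + r}"
proof -
  let ?a = "quantile (\<alpha> / 2)" and ?b = "quantile (1 - \<alpha> / 2)"
  have c: "cdf P ?a = \<alpha> / 2" "cdf P ?b = 1 - \<alpha> / 2"
    using cdf_quantile[of "\<alpha> / 2"] cdf_quantile[of "1 - \<alpha> / 2"] \<alpha> by auto
  have rng: "-M \<le> ?a" "?a \<le> M" "-M \<le> ?b" "?b \<le> M"
    using \<alpha> by (auto intro: quantile_range)
  have r': "\<mu>up * r \<le> \<alpha> / 2" using r up_pos by (simp add: field_simps)
  have "\<mu>up * r \<le> \<mu>up * (?a + M)" "\<mu>up * r \<le> \<mu>up * (M - ?b)"
    using r' cdf_lipschitz[of ?a "-M"] cdf_lipschitz[of M ?b] c rng \<alpha>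
    by (auto simp: cdf_lower_end cdf_upper_end)
  then have "r \<le> ?a + M" "r \<le> M - ?b" using up_pos by auto
  then have "\<mu>low * r \<le> cdf P ?a - cdf P (?a - r)" "\<mu>low * r \<le> cdf P (?b + r) - cdf P ?b"
    using cdf_increase[of "?a - r" ?a] cdf_increase[of ?b "?b + r"] rng r by auto
  then show ?thesis using c by (simp add: prob_Icc_cdf field_simps)
qed

text \<open>
  The oracle interval has mass \<open>1 - \<alpha>\<close>, hence length at least \<open>(1 - \<alpha>) / \<mu>up\<close>, so the narrowed ends do
  not cross and the two removed pieces are disjoint.
\<close>

lemma prob_narrowed:
  assumes \<alpha>: "0 < \<alpha>" "\<alpha> < 1" and r: "0 \<le> r" "r \<le> (1 - \<alpha>) / (2 * \<mu>up)"
  shows "prob {quantile (\<alpha> / 2) + r..quantile (1 - \<alpha> / 2) - r} \<le> 1 - \<alpha> - 2 * \<mu>low * r"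
proof -
  let ?a = "quantile (\<alpha> / 2)" and ?b = "quantile (1 - \<alpha> / 2)"
  have c: "cdf P ?a = \<alpha> / 2" "cdf P ?b = 1 - \<alpha> / 2"
    using cdf_quantile[of "\<alpha> / 2"] cdf_quantile[of "1 - \<alpha> / 2"] \<alpha> by auto
  have rng: "-M \<le> ?a" "?a \<le> M" "-M \<le> ?b" "?b \<le> M"
    using \<alpha> by (auto intro: quantile_range)
  have "\<mu>up * (2 * r) \<le> 1 - \<alpha>" using r up_pos by (simp add: field_simps)
  then have "\<mu>up * (2 * r) \<le> \<mu>up * (?b - ?a)" using quantile_gap[OF \<alpha>] by linarith
  then have ab: "?a + r \<le> ?b - r" using up_pos by auto
  then have "\<mu>low * r \<le> cdf P (?a + r) - cdf P ?a" "\<mu>low * r \<le> cdf P ?b - cdf P (?b - r)"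
    using cdf_increase[of ?a "?a + r"] cdf_increase[of "?b - r" ?b] rng r by auto
  then show ?thesis using c cdf_nondecreasing[OF ab] by (simp add: prob_Icc_cdf field_simps)
qed

end

text \<open>
  The density is bounded by \<open>\<mu>up\<close> on \<open>{-M..M}\<close> only, but the complement is a null set.
\<close>

lemma bounded_density_lawI:
  fixes K :: "real ^ 'd \<Rightarrow> real measure"
  assumes "bounded_response K M" "bounded_density K M \<mu>low \<mu>up"
    and x: "x \<in> unit_cube" and P: "prob_space (K x)" "sets (K x) = sets borel"
  shows "bounded_density_law (K x) M \<mu>low \<mu>up"
proof -
  interpret real_distribution "K x"
    using P by (simp add: real_distribution_def real_distribution_axioms_def)
  have pos: "0 < M" "0 < \<mu>low" and rng: "measure (K x) {-M..M} = 1"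
    using assms by (auto simp: bounded_response_def bounded_density_def)
  obtain p :: "real \<Rightarrow> real" where p[measurable]: "p \<in> borel_measurable borel"
    and K: "K x = density lborel (\<lambda>y. ennreal (p y))"
    and b: "\<And>y. y \<in> {-M..M} \<Longrightarrow> \<mu>low \<le> p y \<and> p y \<le> \<mu>up"
    using assms(2) x by (auto simp: bounded_density_def)
  have up: "0 < \<mu>up" using b[of 0] pos by auto
  have em: "emeasure (K x) A = (\<integral>\<^sup>+y. ennreal (p y) * indicator A y \<partial>lborel)" if "A \<in> sets borel" for A
    using that by (simp add: K emeasure_density)
  show ?thesis
  proof unfold_locales
    fix a b' :: real assume ab: "a \<le> b'"
    have "prob {a..b'} = prob ({a..b'} \<inter> {-M..M})"
      by (rule finite_measure_eq_AE) (use rng prob_eq_1[of "{-M..M}"] in auto)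
    also have "ennreal \<dots> \<le> (\<integral>\<^sup>+y. ennreal \<mu>up * indicator {a..b'} y \<partial>lborel)"
      unfolding emeasure_eq_measure[symmetric]
      by (subst em, simp, rule nn_integral_mono) (use b in \<open>auto simp: indicator_def intro!: ennreal_leI\<close>)
    also have "\<dots> = ennreal (\<mu>up * (b' - a))"
      using ab up by (simp add: nn_integral_cmult ennreal_mult)
    finally show "prob {a..b'} \<le> \<mu>up * (b' - a)" using ab up by simp
  next
    fix a b' :: real assume ab: "-M \<le> a" "a \<le> b'" "b' \<le> M"
    have "ennreal (\<mu>low * (b' - a)) = (\<integral>\<^sup>+y. ennreal \<mu>low * indicator {a..b'} y \<partial>lborel)"
      using ab pos by (simp add: nn_integral_cmult ennreal_mult)
    also have "\<dots> \<le> ennreal (prob {a..b'})"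
      unfolding emeasure_eq_measure[symmetric]
      by (subst em, simp, rule nn_integral_mono) (use b ab in \<open>auto simp: indicator_def intro!: ennreal_leI\<close>)
    finally show "\<mu>low * (b' - a) \<le> prob {a..b'}" by simp
  qed (use pos rng in auto)
qed

section \<open>The L2 norm and product measures\<close>

lemma L2_norm_real:
  assumes "0 \<le> c"
  shows "L2_norm P (\<lambda>x. ereal (g x)) \<le> ereal c \<longleftrightarrow> (\<integral>\<^sup>+x. ennreal ((g x)\<^sup>2) \<partial>P) \<le> ennreal (c\<^sup>2)"
proof -
  let ?I = "\<integral>\<^sup>+x. ennreal ((g x)\<^sup>2) \<partial>P"
  have "L2_norm P (\<lambda>x. ereal (g x)) = (if ?I = \<infinity> then \<infinity> else ereal (sqrt (enn2real ?I)))"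
    by (simp add: L2_norm_def Let_def)
  moreover have "sqrt (enn2real ?I) \<le> c \<longleftrightarrow> ?I \<le> ennreal (c\<^sup>2)" if "?I \<noteq> \<infinity>"
  proof -
    have I: "?I = ennreal (enn2real ?I)" using that by (simp add: less_top)
    have "sqrt (enn2real ?I) \<le> c \<longleftrightarrow> enn2real ?I \<le> c\<^sup>2"
      using assms by (metis enn2real_nonneg real_sqrt_abs abs_of_nonneg real_sqrt_le_iff)
    also have "\<dots> \<longleftrightarrow> ?I \<le> ennreal (c\<^sup>2)"
      by (subst (2) I) (simp add: ennreal_le_iff)
    finally show ?thesis .
  qed
  ultimately show ?thesis by (auto simp: top_unique)
qed

lemma L2_norm_cong: "(\<And>x. x \<in> space P \<Longrightarrow> f x = g x) \<Longrightarrow> L2_norm P f = L2_norm P g"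
  unfolding L2_norm_def by (simp cong: nn_integral_cong_simp)

text \<open>
  The inequality \<open>(a + b + c)\<^sup>2 \<le> 3 * (a\<^sup>2 + b\<^sup>2 + c\<^sup>2)\<close> stands in for Minkowski's inequality, at the price
  of a larger constant.
\<close>

lemma L2_norm_perturbation:
  assumes "prob_space P" and [measurable]: "u \<in> borel_measurable P" "v \<in> borel_measurable P"
    and u: "L2_norm P (\<lambda>x. ereal (u x)) \<le> ereal \<epsilon>"
    and v: "L2_norm P (\<lambda>x. ereal (v x)) \<le> ereal \<epsilon>"
    and nonneg: "0 \<le> \<epsilon>" "0 \<le> c" "0 \<le> k"
    and G: "\<And>x. x \<in> space P \<Longrightarrow> G x = ereal (g x)"
    and g: "\<And>x. x \<in> space P \<Longrightarrow> \<bar>g x\<bar> \<le> k * (\<bar>u x\<bar> + \<bar>v x\<bar> + c)"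
  shows "L2_norm P G \<le> ereal (k * (3 * \<epsilon> + 2 * c))"
proof -
  interpret prob_space P by fact
  have sq: "(g x)\<^sup>2 \<le> 3 * k\<^sup>2 * (u x)\<^sup>2 + 3 * k\<^sup>2 * (v x)\<^sup>2 + 3 * k\<^sup>2 * c\<^sup>2" if "x \<in> space P" for x
  proof -
    let ?a = "\<bar>u x\<bar>" and ?b = "\<bar>v x\<bar>"
    have "3 * (u x)\<^sup>2 + 3 * (v x)\<^sup>2 + 3 * c\<^sup>2 - (?a + ?b + c)\<^sup>2 =
        (?a - ?b)\<^sup>2 + (?b - c)\<^sup>2 + (?a - c)\<^sup>2"
      by (simp add: power2_eq_square algebra_simps)
    moreover have "0 \<le> (?a - ?b)\<^sup>2 + (?b - c)\<^sup>2 + (?a - c)\<^sup>2" by simp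
    ultimately have "(?a + ?b + c)\<^sup>2 \<le> 3 * (u x)\<^sup>2 + 3 * (v x)\<^sup>2 + 3 * c\<^sup>2" by linarith
    then have "k\<^sup>2 * (?a + ?b + c)\<^sup>2 \<le> k\<^sup>2 * (3 * (u x)\<^sup>2 + 3 * (v x)\<^sup>2 + 3 * c\<^sup>2)"
      by (intro mult_left_mono) auto
    moreover have "(g x)\<^sup>2 \<le> k\<^sup>2 * (?a + ?b + c)\<^sup>2"
      using power_mono[OF g[OF that] abs_ge_zero, of 2] by (simp add: power_mult_distrib)
    ultimately show ?thesis by (simp add: algebra_simps)
  qed
  have "(\<integral>\<^sup>+x. ennreal ((g x)\<^sup>2) \<partial>P) \<le>
    (\<integral>\<^sup>+x. ennreal (3 * k\<^sup>2) * ennreal ((u x)\<^sup>2) + ennreal (3 * k\<^sup>2) * ennreal ((v x)\<^sup>2)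
      + ennreal (3 * k\<^sup>2 * c\<^sup>2) \<partial>P)"
    using sq by (intro nn_integral_mono) (simp add: ennreal_leI flip: ennreal_mult ennreal_plus)
  also have "\<dots> = ennreal (3 * k\<^sup>2) * (\<integral>\<^sup>+x. ennreal ((u x)\<^sup>2) \<partial>P) +
      ennreal (3 * k\<^sup>2) * (\<integral>\<^sup>+x. ennreal ((v x)\<^sup>2) \<partial>P) + ennreal (3 * k\<^sup>2 * c\<^sup>2)"
    by (simp add: nn_integral_add nn_integral_cmult emeasure_space_1)
  also have "\<dots> \<le> ennreal (3 * k\<^sup>2) * ennreal (\<epsilon>\<^sup>2) + ennreal (3 * k\<^sup>2) * ennreal (\<epsilon>\<^sup>2)
    + ennreal (3 * k\<^sup>2 * c\<^sup>2)"
    using u v nonneg by (intro add_mono mult_left_mono) (auto simp: L2_norm_real)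
  also have "\<dots> = ennreal (k\<^sup>2 * (6 * \<epsilon>\<^sup>2 + 3 * c\<^sup>2))"
    by (simp add: algebra_simps flip: ennreal_mult ennreal_plus)
  also have "\<dots> \<le> ennreal ((k * (3 * \<epsilon> + 2 * c))\<^sup>2)"
  proof (rule ennreal_leI)
    have "6 * \<epsilon>\<^sup>2 + 3 * c\<^sup>2 \<le> (3 * \<epsilon> + 2 * c)\<^sup>2"
      using nonneg by (simp add: power2_eq_square algebra_simps)
    then show "k\<^sup>2 * (6 * \<epsilon>\<^sup>2 + 3 * c\<^sup>2) \<le> (k * (3 * \<epsilon> + 2 * c))\<^sup>2"
      by (simp add: power_mult_distrib mult_left_mono)
  qed
  finally have "L2_norm P (\<lambda>x. ereal (g x)) \<le> ereal (k * (3 * \<epsilon> + 2 * c))"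
    using nonneg by (subst L2_norm_real) auto
  then show ?thesis by (simp add: G cong: L2_norm_cong)
qed

text \<open>
  Integrating the pointwise inequality \<open>\<bar>u\<bar> \<le> u\<^sup>2 / (2 * \<epsilon>) + \<epsilon> / 2\<close> gives integrability and the
  bound together.
\<close>

lemma
  assumes "prob_space P" and [measurable]: "u \<in> borel_measurable P"
    and u: "L2_norm P (\<lambda>x. ereal (u x)) \<le> ereal \<epsilon>" and \<epsilon>: "0 < \<epsilon>"
  shows L2_norm_imp_integrable: "integrable P (\<lambda>x. \<bar>u x\<bar>)"
    and L2_norm_imp_L1: "(\<integral>x. \<bar>u x\<bar> \<partial>P) \<le> \<epsilon>"
proof -
  interpret prob_space P by fact
  have amgm: "\<bar>u x\<bar> \<le> 1 / (2 * \<epsilon>) * (u x)\<^sup>2 + \<epsilon> / 2" for x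
  proof -
    have "0 \<le> (\<bar>u x\<bar> - \<epsilon>)\<^sup>2" by simp
    also have "\<dots> = (u x)\<^sup>2 - 2 * \<epsilon> * \<bar>u x\<bar> + \<epsilon>\<^sup>2" by (simp add: power2_eq_square algebra_simps)
    finally show ?thesis using \<epsilon> by (simp add: field_simps power2_eq_square)
  qed
  have "(\<integral>\<^sup>+x. ennreal \<bar>u x\<bar> \<partial>P) \<le> (\<integral>\<^sup>+x. ennreal (1 / (2 * \<epsilon>)) * ennreal ((u x)\<^sup>2) + ennreal (\<epsilon> / 2) \<partial>P)"
    using amgm \<epsilon> by (intro nn_integral_mono) (simp add: ennreal_leI flip: ennreal_mult ennreal_plus)
  also have "\<dots> = ennreal (1 / (2 * \<epsilon>)) * (\<integral>\<^sup>+x. ennreal ((u x)\<^sup>2) \<partial>P) + ennreal (\<epsilon> / 2)"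
    by (simp add: nn_integral_add nn_integral_cmult emeasure_space_1)
  also have "\<dots> \<le> ennreal (1 / (2 * \<epsilon>)) * ennreal (\<epsilon>\<^sup>2) + ennreal (\<epsilon> / 2)"
    using u \<epsilon> by (intro add_mono mult_left_mono) (auto simp: L2_norm_real)
  also have "\<dots> = ennreal \<epsilon>"
    using \<epsilon> by (simp add: power2_eq_square flip: ennreal_mult ennreal_plus)
  finally have *: "(\<integral>\<^sup>+x. ennreal \<bar>u x\<bar> \<partial>P) \<le> ennreal \<epsilon>" .
  then show int: "integrable P (\<lambda>x. \<bar>u x\<bar>)"
    by (intro integrableI_bounded) (auto simp: less_top intro: le_less_trans)
  have "ennreal (\<integral>x. \<bar>u x\<bar> \<partial>P) \<le> ennreal \<epsilon>"
    using * int by (simp add: nn_integral_eq_integral)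
  then show "(\<integral>x. \<bar>u x\<bar> \<partial>P) \<le> \<epsilon>" using \<epsilon> by simp
qed

lemma measurable_L2_norm:
  assumes "sigma_finite_measure P"
    and [measurable]: "(\<lambda>z. g (fst z) (snd z)) \<in> borel_measurable (N \<Otimes>\<^sub>M P)"
  shows "(\<lambda>\<omega>. L2_norm P (g \<omega>)) \<in> borel_measurable N"
proof -
  interpret sigma_finite_measure P by fact
  have "(\<lambda>z. e2ennreal (g (fst z) (snd z) * g (fst z) (snd z))) \<in> borel_measurable (N \<Otimes>\<^sub>M P)"
    by measurable
  then have [measurable]: "(\<lambda>\<omega>. \<integral>\<^sup>+x. e2ennreal ((g \<omega> x)\<^sup>2) \<partial>P) \<in> borel_measurable N"
    by (intro borel_measurable_nn_integral) (simp add: power2_eq_square case_prod_beta')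
  show ?thesis unfolding L2_norm_def Let_def by measurable
qed

text \<open>
  The sections of \<open>G\<close> only have to contain a large event \<open>F\<close>, which may depend on \<open>x\<close> in an arbitrary,
  not necessarily measurable way: the event of good calibration samples depends on the training sample.
\<close>

lemma prob_pair_lower_bound:
  assumes "prob_space A" "prob_space B" and G: "G \<in> sets (A \<Otimes>\<^sub>M B)"
    and E: "E \<in> sets A" "a \<le> measure A E" and ab: "0 \<le> a" "0 \<le> b"
    and sect: "\<And>x. x \<in> E \<Longrightarrow> \<exists>F\<in>sets B. b \<le> measure B F \<and> {x} \<times> F \<subseteq> G"
  shows "a * b \<le> measure (A \<Otimes>\<^sub>M B) G"
proof -
  interpret A: prob_space A by fact
  interpret B: prob_space B by fact
  interpret AB: pair_prob_space A B ..
  have "ennreal (a * b) \<le> ennreal b * emeasure A E"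
    using mult_left_mono[OF E(2) ab(2)] ab
    by (simp add: A.emeasure_eq_measure mult.commute ennreal_leI flip: ennreal_mult)
  also have "\<dots> = (\<integral>\<^sup>+x. ennreal b * indicator E x \<partial>A)"
    using E by (simp add: nn_integral_cmult)
  also have "\<dots> \<le> (\<integral>\<^sup>+x. emeasure B (Pair x -` G) \<partial>A)"
  proof (intro nn_integral_mono)
    fix x assume "x \<in> space A"
    show "ennreal b * indicator E x \<le> emeasure B (Pair x -` G)"
    proof (cases "x \<in> E")
      case True
      from sect[OF this] obtain F where F: "F \<in> sets B" "b \<le> measure B F" "{x} \<times> F \<subseteq> G" by auto
      then have "ennreal b \<le> emeasure B F" by (simp add: B.emeasure_eq_measure ennreal_leI)
      also have "\<dots> \<le> emeasure B (Pair x -` G)"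
        using F G by (intro emeasure_mono sets_Pair1) auto
      finally show ?thesis using True by simp
    qed simp
  qed
  also have "\<dots> = ennreal (measure (A \<Otimes>\<^sub>M B) G)"
    using G by (simp add: B.emeasure_pair_measure_alt flip: AB.emeasure_eq_measure)
  finally show ?thesis by simp
qed

section \<open>Empirical frequencies and the conformal quantile\<close>

text \<open>
  The indicators of \<open>D i \<in> A\<close> are independent copies of a variable with values in \<open>{0..1}\<close> and mean
  \<open>measure N A\<close>, so these are the two one-sided Hoeffding bounds.
\<close>

lemma
  fixes N :: "'a measure"
  assumes N: "prob_space N" and A[measurable]: "A \<in> sets N" and m: "0 < m" and \<eta>: "0 \<le> \<eta>"
  defines "S \<equiv> PiM {..<m} (\<lambda>_. N)"
  shows empirical_frequency_lower_tail:
      "measure S {D \<in> space S. (\<Sum>i<m. of_bool (D i \<in> A)) / real m \<le> measure N A - \<eta>}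
        \<le> exp (- 2 * real m * \<eta>\<^sup>2)"
    and empirical_frequency_upper_tail:
      "measure S {D \<in> space S. (\<Sum>i<m. of_bool (D i \<in> A)) / real m \<ge> measure N A + \<eta>}
        \<le> exp (- 2 * real m * \<eta>\<^sup>2)"
proof -
  interpret S: prob_space S unfolding S_def by (intro prob_space_PiM N)
  have comp: "distr S N (\<lambda>D. D i) = N" if "i < m" for i
    unfolding S_def using distr_PiM_component[of "{..<m}" "\<lambda>_. N" i] N that by simp
  have proj[measurable]: "(\<lambda>D. D i) \<in> S \<rightarrow>\<^sub>M N" if "i < m" for i
    unfolding S_def using that by (intro measurable_component_singleton) auto
  have indep: "S.indep_vars (\<lambda>_. N) (\<lambda>i D. D i) {..<m}"
  proof (subst S.indep_vars_iff_distr_eq_PiM')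
    have "distr S S (\<lambda>D. \<lambda>i\<in>{..<m}. D i) = distr S S (\<lambda>D. D)"
      by (intro distr_cong) (auto simp: S_def space_PiM PiE_def extensional_restrict)
    also have "\<dots> = PiM {..<m} (\<lambda>i. distr S N (\<lambda>D. D i))"
      unfolding distr_id by (simp add: S_def cong: PiM_cong) (metis (mono_tags, lifting) PiM_cong S_def comp lessThan_iff)
    finally show "distr S (PiM {..<m} (\<lambda>_. N)) (\<lambda>D. \<lambda>i\<in>{..<m}. D i) = PiM {..<m} (\<lambda>i. distr S N (\<lambda>D. D i))"
      by (simp add: S_def)
  qed (use m in auto)
  interpret Hoeffding_ineq_iid S "{..<m}" "\<lambda>i D. of_bool (D i \<in> A)" "\<lambda>D. of_bool (D 0 \<in> A)" 0 1 "measure N A"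
  proof unfold_locales
    show "S.indep_vars (\<lambda>_. borel) (\<lambda>i D. of_bool (D i \<in> A)) {..<m}"
      by (rule S.indep_vars_compose2[OF indep]) measurable
    show "distr S borel (\<lambda>D. of_bool (D i \<in> A) :: real) = distr S borel (\<lambda>D. of_bool (D 0 \<in> A))"
      if "i \<in> {..<m}" for i
    proof -
      have "distr S borel (\<lambda>D. of_bool (D j \<in> A) :: real) = distr N borel (\<lambda>z. of_bool (z \<in> A))"
        if j: "j < m" for j
      proof -
        have "distr S borel (\<lambda>D. of_bool (D j \<in> A) :: real) =
              distr (distr S N (\<lambda>D. D j)) borel (\<lambda>z. of_bool (z \<in> A))"
          using j by (subst distr_distr) (auto simp: o_def)
        then show ?thesis by (simp add: comp j)
      qed
      with that m show ?thesis by simp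
    qed
    have "S.expectation (\<lambda>D. of_bool (D 0 \<in> A) :: real)
      = integral\<^sup>L (distr S N (\<lambda>D. D 0)) (\<lambda>z. of_bool (z \<in> A))"
      using m by (subst integral_distr) auto
    also have "\<dots> = (\<integral>z. indicator A z \<partial>N)"
      by (simp add: comp m indicator_def of_bool_def)
    finally show "measure N A \<equiv> S.expectation (\<lambda>D. of_bool (D 0 \<in> A))"
      by (simp add: sets.Int_space_eq2)
  qed (use m in auto)
  from Hoeffding_ineq_le'[OF \<eta>] Hoeffding_ineq_ge'[OF \<eta>] m
  show "measure S {D \<in> space S. (\<Sum>i<m. of_bool (D i \<in> A)) / real m \<le> measure N A - \<eta>}
    \<le> exp (- 2 * real m * \<eta>\<^sup>2)"
    "measure S {D \<in> space S. (\<Sum>i<m. of_bool (D i \<in> A)) / real m \<ge> measure N A + \<eta>}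
      \<le> exp (- 2 * real m * \<eta>\<^sup>2)"
    by (auto simp: lessThan_empty_iff)
qed

definition score_frequency :: "('a \<Rightarrow> real) \<Rightarrow> ('a \<Rightarrow> real) \<Rightarrow> nat \<Rightarrow> (nat \<Rightarrow> 'a \<times> real) \<Rightarrow> real \<Rightarrow> real" where
  "score_frequency lo hi m D t =
     (\<Sum>i<m. of_bool (score lo hi (fst (D i)) (snd (D i)) \<le> t)) / real m"

lemma score_frequency_mono: "s \<le> t \<Longrightarrow> score_frequency lo hi m D s \<le> score_frequency lo hi m D t"
  unfolding score_frequency_def by (intro divide_right_mono sum_mono) (auto simp: of_bool_def)

lemma conformal_quantile_le:
  assumes "conformal_level \<alpha> m \<le> score_frequency lo hi m D t"
  shows "conformal_quantile \<alpha> lo hi m D \<le> ereal t"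
  using assms unfolding conformal_quantile_def score_frequency_def by (intro Inf_lower) auto

text \<open>
  The frequency is nondecreasing, so a frequency below the level at \<open>t\<close> excludes all smaller thresholds.
\<close>

lemma conformal_quantile_ge:
  assumes "score_frequency lo hi m D t < conformal_level \<alpha> m"
  shows "ereal t \<le> conformal_quantile \<alpha> lo hi m D"
  unfolding conformal_quantile_def
proof (intro Inf_greatest, elim imageE CollectE)
  fix u s assume u: "u = ereal s"
    and "conformal_level \<alpha> m \<le> (\<Sum>i<m. of_bool (score lo hi (fst (D i)) (snd (D i)) \<le> s)) / real m"
  then have "score_frequency lo hi m D t < score_frequency lo hi m D s"
    using assms by (simp add: score_frequency_def)
  then show "ereal t \<le> u"
    using score_frequency_mono[of s t lo hi m D] u by (cases "t \<le> s") auto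
qed

lemma score_le_iff: "score lo hi x y \<le> t \<longleftrightarrow> lo x - t \<le> y \<and> y \<le> hi x + t"
  by (auto simp: score_def)

lemma cqr_set_eq_Icc:
  "conformal_quantile \<alpha> lo hi m D = ereal q \<Longrightarrow> cqr_set \<alpha> lo hi m D x = {lo x - q..hi x + q}"
  by (auto simp: cqr_set_def score_le_iff)

lemma conformal_level_bounds:
  assumes "0 < m"
  shows "1 - \<alpha> \<le> conformal_level \<alpha> m - (1 - \<alpha>) / real m"
    and "conformal_level \<alpha> m \<le> 1 - \<alpha> + (2 - \<alpha>) / real m"
proof -
  define c where "c = real_of_int \<lceil>(real m + 1) * (1 - \<alpha>)\<rceil>"
  have "(real m + 1) * (1 - \<alpha>) \<le> c" "c \<le> (real m + 1) * (1 - \<alpha>) + 1"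
    unfolding c_def by linarith+
  then show "1 - \<alpha> \<le> conformal_level \<alpha> m - (1 - \<alpha>) / real m"
    "conformal_level \<alpha> m \<le> 1 - \<alpha> + (2 - \<alpha>) / real m"
    using assms unfolding conformal_level_def c_def[symmetric] by (auto simp: field_simps)
qed

text \<open>
  Matching in sorted order is the cheapest way to match two pairs of reals, so sorting does not increase the
  total distance to the ordered pair of oracle endpoints.
\<close>

lemma sort_error_le:
  assumes "a x \<le> b x"
  shows "\<bar>sort_lower f g x - a x\<bar> + \<bar>sort_upper f g x - b x\<bar> \<le> \<bar>f x - a x\<bar> + \<bar>g x - b x\<bar>"
  using assms by (auto simp: sort_lower_def sort_upper_def)

text \<open>
  An infimum over countably many thresholds, each contributing a measurable function of the data, makes the
  quantile measurable. Rational thresholds suffice by monotonicity of the frequency.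
\<close>

lemma conformal_quantile_rational:
  "conformal_quantile \<alpha> lo hi m D =
     (INF q\<in>\<rat>. if conformal_level \<alpha> m \<le> score_frequency lo hi m D q then ereal q else \<infinity>)"
    (is "_ = Inf (?g ` _)")
proof (rule antisym)
  show "conformal_quantile \<alpha> lo hi m D \<le> Inf (?g ` \<rat>)"
    by (intro INF_greatest) (auto intro: conformal_quantile_le)
  show "Inf (?g ` \<rat>) \<le> conformal_quantile \<alpha> lo hi m D"
    unfolding conformal_quantile_def
  proof (intro Inf_greatest, elim imageE CollectE)
    fix u t assume u: "u = ereal t"
      and t: "conformal_level \<alpha> m \<le> (\<Sum>i<m. of_bool (score lo hi (fst (D i)) (snd (D i)) \<le> t)) / real m"
    show "Inf (?g ` \<rat>) \<le> u"
    proof (rule dense_ge)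
      fix z assume "u < z"
      then have "\<exists>s. ereal t < ereal s \<and> ereal s \<le> z"
        using u ereal_dense2[of u z] by (metis less_imp_le)
      then obtain s where s: "t < s" "ereal s \<le> z" by auto
      obtain q where q: "q \<in> \<rat>" "t < q" "q < s" using Rats_dense_in_real[OF s(1)] by auto
      have "conformal_level \<alpha> m \<le> score_frequency lo hi m D q"
        using t score_frequency_mono[of t q lo hi m D] q by (simp add: score_frequency_def)
      then have "Inf (?g ` \<rat>) \<le> ereal q" using q(1) by (intro INF_lower2[of q]) auto
      also have "\<dots> \<le> ereal s" using q by simp
      finally show "Inf (?g ` \<rat>) \<le> z" using s(2) by simp
    qed
  qed
qed

text \<open>
  The scale is chosen such that one one-sided Hoeffding bound equals a quarter of \<open>\<delta>\<close>.
\<close>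

lemma exp_eta_scale:
  assumes "0 < \<delta>" "\<delta> < 1" "0 < m"
  shows "0 \<le> eta_scale m \<delta>" "exp (- 2 * real m * (eta_scale m \<delta>)\<^sup>2) = \<delta> / 4"
proof -
  have l: "0 \<le> ln (4 / \<delta>)" using assms by simp
  then show "0 \<le> eta_scale m \<delta>" by (simp add: eta_scale_def)
  have "2 * real m * (eta_scale m \<delta>)\<^sup>2 = ln (4 / \<delta>)"
    using l assms by (simp add: eta_scale_def)
  then show "exp (- 2 * real m * (eta_scale m \<delta>)\<^sup>2) = \<delta> / 4"
    using assms by (simp add: exp_minus)
qed

section \<open>The regression model and its joint law\<close>

locale quantile_regression_model = prob_space PX
  for PX :: "(real ^ 'd) measure" +
  fixes K :: "real ^ 'd \<Rightarrow> real measure" and M \<mu>low \<mu>up \<alpha> :: real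
  assumes model: "regression_model PX K" "bounded_response K M" "bounded_density K M \<mu>low \<mu>up"
    and \<alpha>: "0 < \<alpha>" "\<alpha> < 1"
begin

lemma sets_PX: "sets PX = sets (restrict_space borel unit_cube)"
  and kernel[measurable]: "K \<in> PX \<rightarrow>\<^sub>M prob_algebra borel"
  using model(1) by (auto simp: regression_model_def)

lemma space_PX: "space PX = unit_cube"
  using sets_eq_imp_space_eq[OF sets_PX] by (simp add: space_restrict_space)

lemma kernel_law: "x \<in> space PX \<Longrightarrow> bounded_density_law (K x) M \<mu>low \<mu>up"
  using measurable_space[OF kernel, of x] model
  by (intro bounded_density_lawI) (auto simp: space_prob_algebra space_PX)

lemma pos: "0 < M" "0 < \<mu>low" "0 < \<mu>up" "1 \<le> 2 * M * \<mu>up" "\<mu>low \<le> \<mu>up"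
proof -
  obtain x where "x \<in> space PX" using not_empty by blast
  then interpret Kx: bounded_density_law "K x" M \<mu>low \<mu>up by (rule kernel_law)
  show "0 < M" "0 < \<mu>low" "0 < \<mu>up" "1 \<le> 2 * M * \<mu>up" "\<mu>low \<le> \<mu>up"
    by (rule Kx.M_pos Kx.low_pos Kx.up_pos Kx.upper_range Kx.low_le_up)+
qed

abbreviation "qlo \<equiv> cond_quantile K (\<alpha> / 2)"
abbreviation "qhi \<equiv> cond_quantile K (1 - \<alpha> / 2)"

lemma cond_quantile_eq: "x \<in> space PX \<Longrightarrow> cond_quantile K \<tau> x = bounded_density_law.quantile (K x) \<tau>"
  by (simp add: cond_quantile_def bounded_density_law.quantile_def[OF kernel_law] cdf_def2)

lemma qlo_le_qhi: "x \<in> space PX \<Longrightarrow> qlo x \<le> qhi x"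
  using bounded_density_law.quantile_mono[OF kernel_law \<alpha>] by (simp add: cond_quantile_eq)

lemma coverage_perturb:
  "x \<in> space PX \<Longrightarrow> \<bar>measure (K x) {a..b} - measure (K x) {a'..b'}\<bar> \<le> \<mu>up * (\<bar>a - a'\<bar> + \<bar>b - b'\<bar>)"
  by (rule bounded_density_law.prob_Icc_perturb[OF kernel_law])

lemma coverage_oracle: "x \<in> space PX \<Longrightarrow> measure (K x) {qlo x..qhi x} = 1 - \<alpha>"
  using bounded_density_law.prob_quantiles[OF kernel_law \<alpha>] by (simp add: cond_quantile_eq)

text \<open>
  The sublevel sets are described by the kernel, through \<open>\<tau> \<le> measure (K x) {..t}\<close>.
\<close>

lemma measurable_cond_quantile[measurable]:
  assumes "0 < \<tau>" "\<tau> < 1"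
  shows "cond_quantile K \<tau> \<in> borel_measurable PX"
proof (subst borel_measurable_iff_le, intro allI)
  fix t :: real
  have "{x \<in> space PX. cond_quantile K \<tau> x \<le> t} = {x \<in> space PX. \<tau> \<le> measure (K x) {..t}}"
    using bounded_density_law.quantile_le_iff[OF kernel_law assms]
    by (auto simp: cond_quantile_eq cdf_def2)
  also have "\<dots> \<in> sets PX"
    by measurable
  finally show "{x \<in> space PX. cond_quantile K \<tau> x \<le> t} \<in> sets PX" .
qed

lemma measurable_qlo[measurable]: "qlo \<in> borel_measurable PX"
  and measurable_qhi[measurable]: "qhi \<in> borel_measurable PX"
  using \<alpha> by (auto intro: measurable_cond_quantile)

abbreviation "PXY \<equiv> joint_law PX K"

lemma joint_kernel: "(\<lambda>x. distr (K x) (PX \<Otimes>\<^sub>M borel) (\<lambda>y. (x, y))) \<in> PX \<rightarrow>\<^sub>M prob_algebra (PX \<Otimes>\<^sub>M borel)"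
  by measurable

lemma PX_prob_algebra: "PX \<in> space (prob_algebra PX)"
  by (simp add: space_prob_algebra prob_space_axioms)

lemma prob_space_PXY: "prob_space PXY"
  and sets_PXY[measurable_cong, simp]: "sets PXY = sets (PX \<Otimes>\<^sub>M borel)"
  unfolding joint_law_def
  using prob_space_bind'[OF PX_prob_algebra joint_kernel] sets_bind'[OF PX_prob_algebra joint_kernel]
  by auto

lemma emeasure_PXY:
  assumes A[measurable]: "A \<in> sets (PX \<Otimes>\<^sub>M borel)"
  shows "emeasure PXY A = (\<integral>\<^sup>+x. emeasure (K x) (Pair x -` A) \<partial>PX)"
proof -
  have "emeasure PXY A = (\<integral>\<^sup>+x. emeasure (distr (K x) (PX \<Otimes>\<^sub>M borel) (\<lambda>y. (x, y))) A \<partial>PX)"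
    unfolding joint_law_def by (rule emeasure_bind_prob_algebra[OF PX_prob_algebra joint_kernel A])
  also have "\<dots> = (\<integral>\<^sup>+x. emeasure (K x) (Pair x -` A) \<partial>PX)"
  proof (rule nn_integral_cong)
    fix x assume x: "x \<in> space PX"
    then interpret Kx: bounded_density_law "K x" M \<mu>low \<mu>up by (rule kernel_law)
    show "emeasure (distr (K x) (PX \<Otimes>\<^sub>M borel) (\<lambda>y. (x, y))) A = emeasure (K x) (Pair x -` A)"
      using x by (subst emeasure_distr) auto
  qed
  finally show ?thesis .
qed

section \<open>The distribution of the score\<close>

definition score_cdf :: "(real ^ 'd \<Rightarrow> real) \<Rightarrow> (real ^ 'd \<Rightarrow> real) \<Rightarrow> real \<Rightarrow> real" where
  "score_cdf lo hi t = measure PXY {z \<in> space PXY. score lo hi (fst z) (snd z) \<le> t}"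

lemma measurable_Icc_prob[measurable]:
  assumes [measurable]: "lo \<in> borel_measurable PX" "hi \<in> borel_measurable PX"
  shows "(\<lambda>x. measure (K x) {lo x..hi x}) \<in> borel_measurable PX"
proof (rule measure_measurable_prob_algebra2[OF _ kernel])
  have "(SIGMA x:space PX. {lo x..hi x}) = {z \<in> space (PX \<Otimes>\<^sub>M borel). lo (fst z) \<le> snd z \<and> snd z
    \<le> hi (fst z)}"
    by (auto simp: space_pair_measure)
  also have "\<dots> \<in> sets (PX \<Otimes>\<^sub>M borel)" by measurable
  finally show "(SIGMA x:space PX. {lo x..hi x}) \<in> sets (PX \<Otimes>\<^sub>M borel)" .
qed

lemma score_event:
  assumes [measurable]: "lo \<in> borel_measurable PX" "hi \<in> borel_measurable PX"
  shows "{z \<in> space PXY. score lo hi (fst z) (snd z) \<le> t} \<in> sets PXY"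
  unfolding score_le_iff by measurable

lemma integrable_Icc_prob:
  assumes [measurable]: "lo \<in> borel_measurable PX" "hi \<in> borel_measurable PX"
  shows "integrable PX (\<lambda>x. measure (K x) {lo x..hi x})"
proof (rule integrable_const_bound[where B = 1])
  show "AE x in PX. norm (measure (K x) {lo x..hi x}) \<le> 1"
  proof (rule AE_I2)
    fix x assume "x \<in> space PX"
    then interpret Kx: bounded_density_law "K x" M \<mu>low \<mu>up by (rule kernel_law)
    show "norm (measure (K x) {lo x..hi x}) \<le> 1" by simp
  qed
qed measurable

lemma score_cdf_eq:
  assumes [measurable]: "lo \<in> borel_measurable PX" "hi \<in> borel_measurable PX"
  shows "score_cdf lo hi t = (\<integral>x. measure (K x) {lo x - t..hi x + t} \<partial>PX)"
proof -
  interpret PXY: prob_space PXY by (rule prob_space_PXY)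
  have "emeasure PXY {z \<in> space PXY. score lo hi (fst z) (snd z) \<le> t} =
    (\<integral>\<^sup>+x. emeasure (K x) (Pair x -` {z \<in> space PXY. score lo hi (fst z) (snd z) \<le> t}) \<partial>PX)"
    using score_event[OF assms] by (intro emeasure_PXY) simp
  also have "\<dots> = (\<integral>\<^sup>+x. ennreal (measure (K x) {lo x - t..hi x + t}) \<partial>PX)"
  proof (rule nn_integral_cong)
    fix x assume x: "x \<in> space PX"
    then interpret Kx: bounded_density_law "K x" M \<mu>low \<mu>up by (rule kernel_law)
    have "Pair x -` {z \<in> space PXY. score lo hi (fst z) (snd z) \<le> t} = {lo x - t..hi x + t}"
      using x sets_eq_imp_space_eq[OF sets_PXY] by (auto simp: space_pair_measure score_le_iff)
    then show "emeasure (K x) (Pair x -` {z \<in> space PXY. score lo hi (fst z) (snd z) \<le> t}) =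
        ennreal (measure (K x) {lo x - t..hi x + t})"
      by (simp add: Kx.emeasure_eq_measure)
  qed
  also have "\<dots> = ennreal (\<integral>x. measure (K x) {lo x - t..hi x + t} \<partial>PX)"
    by (intro nn_integral_eq_integral integrable_Icc_prob) auto
  finally show ?thesis
    unfolding score_cdf_def by (simp add: PXY.emeasure_eq_measure integral_nonneg)
qed

text \<open>
  Averaging over \<open>x\<close>: the oracle endpoints satisfy the bounds without \<open>\<mu>up * e\<close> for every \<open>x\<close>, and the
  replacement of the endpoints changes the conditional probability by at most \<open>\<mu>up\<close> times their total
  error at \<open>x\<close>.
\<close>

lemma
  assumes [measurable]: "lo \<in> borel_measurable PX" "hi \<in> borel_measurable PX"
    and err: "integrable PX (\<lambda>x. \<bar>lo x - qlo x\<bar> + \<bar>hi x - qhi x\<bar>)"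
      "(\<integral>x. \<bar>lo x - qlo x\<bar> + \<bar>hi x - qhi x\<bar> \<partial>PX) \<le> e"
    and r: "0 \<le> r"
  shows score_cdf_widened: "r \<le> \<alpha> / (2 * \<mu>up) \<Longrightarrow> 1 - \<alpha> + 2 * \<mu>low * r - \<mu>up * e \<le> score_cdf lo hi r"
    and score_cdf_narrowed: "r \<le> (1 - \<alpha>) / (2 * \<mu>up) \<Longrightarrow> score_cdf lo hi (-r)
      \<le> 1 - \<alpha> - 2 * \<mu>low * r + \<mu>up * e"
proof -
  let ?e = "\<lambda>x. \<bar>lo x - qlo x\<bar> + \<bar>hi x - qhi x\<bar>"
  have dev: "\<bar>measure (K x) {lo x - t..hi x + t} - measure (K x) {qlo x - t..qhi x + t}\<bar> \<le> \<mu>up * ?e x"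
    if "x \<in> space PX" for x t
    using coverage_perturb[OF that, of "lo x - t" "hi x + t" "qlo x - t" "qhi x + t"] by simp
  have e: "\<mu>up * (\<integral>x. ?e x \<partial>PX) \<le> \<mu>up * e"
    using err(2) pos by simp
  show "1 - \<alpha> + 2 * \<mu>low * r - \<mu>up * e \<le> score_cdf lo hi r" if r': "r \<le> \<alpha> / (2 * \<mu>up)"
  proof -
    have "1 - \<alpha> + 2 * \<mu>low * r - \<mu>up * e \<le> (\<integral>x. (1 - \<alpha> + 2 * \<mu>low * r) - \<mu>up * ?e x \<partial>PX)"
      using err(1) e by (simp add: prob_space)
    also have "\<dots> \<le> (\<integral>x. measure (K x) {lo x - r..hi x + r} \<partial>PX)"
    proof (rule integral_mono)
      show "1 - \<alpha> + 2 * \<mu>low * r - \<mu>up * ?e x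
        \<le> measure (K x) {lo x - r..hi x + r}" if x: "x \<in> space PX" for x
        using dev[OF x, of r] bounded_density_law.prob_widened[OF kernel_law[OF x] \<alpha> r r']
        by (simp add: cond_quantile_eq[OF x])
    qed (use err(1) in \<open>auto intro!: integrable_Icc_prob\<close>)
    finally show ?thesis by (simp add: score_cdf_eq)
  qed
  show "score_cdf lo hi (-r) \<le> 1 - \<alpha> - 2 * \<mu>low * r + \<mu>up * e" if r': "r \<le> (1 - \<alpha>) / (2 * \<mu>up)"
  proof -
    have "(\<integral>x. measure (K x) {lo x - (-r)..hi x + (-r)} \<partial>PX)
      \<le> (\<integral>x. (1 - \<alpha> - 2 * \<mu>low * r) + \<mu>up * ?e x \<partial>PX)"
    proof (rule integral_mono)
      show "measure (K x) {lo x - (-r)..hi x + (-r)}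
        \<le> 1 - \<alpha> - 2 * \<mu>low * r + \<mu>up * ?e x" if x: "x \<in> space PX" for x
        using dev[OF x, of "-r"] bounded_density_law.prob_narrowed[OF kernel_law[OF x] \<alpha> r r']
        by (simp add: cond_quantile_eq[OF x])
    qed (use err(1) in \<open>auto intro!: integrable_Icc_prob\<close>)
    also have "\<dots> \<le> 1 - \<alpha> - 2 * \<mu>low * r + \<mu>up * e"
      using err(1) e by (simp add: prob_space)
    finally show ?thesis by (simp add: score_cdf_eq)
  qed
qed

section \<open>Measurability of the conformal procedure\<close>

abbreviation "sample n \<equiv> sample_law PX K n"

lemma prob_space_sample: "prob_space (sample n)"
  unfolding sample_law_def by (intro prob_space_PiM prob_space_PXY)

text \<open>
  Here \<open>N\<close> is any source of randomness for endpoints and calibration data. It will be the pair of samples,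
  and, for fixed endpoints, the calibration sample alone.
\<close>

lemma measurable_score_frequency:
  assumes [measurable]: "(\<lambda>z. lo (fst z) (snd z)) \<in> borel_measurable (N \<Otimes>\<^sub>M PX)"
      "(\<lambda>z. hi (fst z) (snd z)) \<in> borel_measurable (N \<Otimes>\<^sub>M PX)"
    and D: "D \<in> N \<rightarrow>\<^sub>M sample m"
  shows "(\<lambda>\<omega>. score_frequency (lo \<omega>) (hi \<omega>) m (D \<omega>) t) \<in> borel_measurable N"
  unfolding score_frequency_def
proof (intro borel_measurable_divide borel_measurable_sum borel_measurable_const)
  fix i assume i: "i \<in> {..<m}"
  have "(\<lambda>\<omega>. D \<omega> i) \<in> N \<rightarrow>\<^sub>M PXY"
    using measurable_compose[OF D, unfolded sample_law_def, OF measurable_component_singleton, OF i] .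
  then have [measurable]: "(\<lambda>\<omega>. D \<omega> i) \<in> N \<rightarrow>\<^sub>M PX \<Otimes>\<^sub>M borel"
    by (simp cong: measurable_cong_sets)
  have [measurable]: "(\<lambda>\<omega>. lo \<omega> (fst (D \<omega> i))) \<in> borel_measurable N"
    using measurable_compose[of "\<lambda>\<omega>. (\<omega>, fst (D \<omega> i))" N "N \<Otimes>\<^sub>M PX" "\<lambda>z. lo (fst z) (snd z)" borel] by simp
  have [measurable]: "(\<lambda>\<omega>. hi \<omega> (fst (D \<omega> i))) \<in> borel_measurable N"
    using measurable_compose[of "\<lambda>\<omega>. (\<omega>, fst (D \<omega> i))" N "N \<Otimes>\<^sub>M PX" "\<lambda>z. hi (fst z) (snd z)" borel] by simp
  show "(\<lambda>\<omega>. of_bool (score (lo \<omega>) (hi \<omega>) (fst (D \<omega> i)) (snd (D \<omega> i)) \<le> t) :: real) \<in> borel_measurable N"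
    unfolding score_le_iff by measurable
qed

lemma measurable_conformal_quantile:
  assumes "(\<lambda>z. lo (fst z) (snd z)) \<in> borel_measurable (N \<Otimes>\<^sub>M PX)"
      "(\<lambda>z. hi (fst z) (snd z)) \<in> borel_measurable (N \<Otimes>\<^sub>M PX)"
    and "D \<in> N \<rightarrow>\<^sub>M sample m"
  shows "(\<lambda>\<omega>. conformal_quantile \<alpha> (lo \<omega>) (hi \<omega>) m (D \<omega>)) \<in> borel_measurable N"
proof -
  note [measurable] = measurable_score_frequency[OF assms]
  show ?thesis
    unfolding conformal_quantile_rational
    by (intro borel_measurable_INF countable_rat) measurable
qed

text \<open>
  The graph of the prediction set is measurable in all variables jointly, so length and coverage are
  measurable as measures of its sections, the coverage by means of the kernel.
\<close>

lemma measurable_errors: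
  assumes [measurable]: "(\<lambda>z. lo (fst z) (snd z)) \<in> borel_measurable (N \<Otimes>\<^sub>M PX)"
      "(\<lambda>z. hi (fst z) (snd z)) \<in> borel_measurable (N \<Otimes>\<^sub>M PX)"
    and D: "D \<in> N \<rightarrow>\<^sub>M sample m"
  shows "(\<lambda>\<omega>. length_error PX (cqr_set \<alpha> (lo \<omega>) (hi \<omega>) m (D \<omega>)) (oracle_interval K \<alpha>)) \<in> borel_measurable N"
    (is "?length")
    and "(\<lambda>\<omega>. coverage_error PX K \<alpha> (cqr_set \<alpha> (lo \<omega>) (hi \<omega>) m (D \<omega>))) \<in> borel_measurable N"
    (is "?coverage")
proof -
  let ?C = "\<lambda>z. cqr_set \<alpha> (lo (fst z)) (hi (fst z)) m (D (fst z)) (snd z)"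
  note [measurable] = measurable_conformal_quantile[OF assms]
  have "(SIGMA z:space (N \<Otimes>\<^sub>M PX). ?C z) =
    {w \<in> space ((N \<Otimes>\<^sub>M PX) \<Otimes>\<^sub>M borel). ereal (max (lo (fst (fst w)) (snd (fst w)) - snd w) (snd w - hi (fst (fst w)) (snd (fst w))))
        \<le> conformal_quantile \<alpha> (lo (fst (fst w))) (hi (fst (fst w))) m (D (fst (fst w)))}"
    by (auto simp: cqr_set_def score_def space_pair_measure)
  also have "\<dots> \<in> sets ((N \<Otimes>\<^sub>M PX) \<Otimes>\<^sub>M borel)" by measurable
  finally have C: "(SIGMA z:space (N \<Otimes>\<^sub>M PX). ?C z) \<in> sets ((N \<Otimes>\<^sub>M PX) \<Otimes>\<^sub>M borel)" .
  have [measurable]: "(\<lambda>z. emeasure lborel (?C z)) \<in> borel_measurable (N \<Otimes>\<^sub>M PX)"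
  proof -
    have "(\<lambda>z. emeasure lborel (Pair z -` (SIGMA z:space (N \<Otimes>\<^sub>M PX). ?C z))) \<in> borel_measurable (N \<Otimes>\<^sub>M PX)"
      using C by (intro lborel.measurable_emeasure_Pair) (simp cong: sets_pair_measure_cong)
    then show ?thesis
      by (rule measurable_cong[THEN iffD1, rotated]) (auto intro!: arg_cong[where f = "emeasure lborel"])
  qed
  have [measurable]: "(\<lambda>z. measure (K (snd z)) (?C z)) \<in> borel_measurable (N \<Otimes>\<^sub>M PX)"
    by (rule measure_measurable_prob_algebra2[OF C]) measurable
  have [measurable]: "(\<lambda>x. emeasure lborel (oracle_interval K \<alpha> x)) \<in> borel_measurable PX"
  proof -
    have "(\<lambda>x. ennreal (qhi x - qlo x)) \<in> borel_measurable PX" by measurable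
    then show ?thesis
      by (rule measurable_cong[THEN iffD1, rotated]) (simp add: oracle_interval_def qlo_le_qhi)
  qed
  show ?length unfolding length_error_def
    by (rule measurable_L2_norm) (auto simp: sigma_finite_measure_axioms)
  show ?coverage unfolding coverage_error_def coverage_def
    by (rule measurable_L2_norm) (auto simp: sigma_finite_measure_axioms)
qed

section \<open>The conformal quantile is close to zero\<close>

text \<open>
  The conformal level exceeds \<open>1 - \<alpha>\<close>, so a frequency of at most \<open>1 - \<alpha>\<close> at \<open>s\<close> keeps the quantile
  from falling below \<open>s\<close>, and a frequency at \<open>t\<close> that reaches the level keeps it from exceeding \<open>t\<close>.
  Each of these two events fails with probability at most \<open>\<delta> / 4\<close>.
\<close>

lemma calibration:
  assumes lo: "lo \<in> borel_measurable PX" and hi: "hi \<in> borel_measurable PX"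
    and m: "0 < m" and \<delta>: "0 < \<delta>" "\<delta> < 1"
    and below: "score_cdf lo hi s + eta_scale m \<delta> \<le> 1 - \<alpha>"
    and above: "conformal_level \<alpha> m + eta_scale m \<delta> \<le> score_cdf lo hi t"
  shows "\<exists>F\<in>sets (sample m). 1 - \<delta> / 2 \<le> measure (sample m) F \<and>
    (\<forall>D\<in>F. ereal s \<le> conformal_quantile \<alpha> lo hi m D \<and> conformal_quantile \<alpha> lo hi m D \<le> ereal t)"
proof -
  interpret S: prob_space "sample m" by (rule prob_space_sample)
  define \<eta> where "\<eta> = eta_scale m \<delta>"
  let ?A = "\<lambda>u. {z \<in> space PXY. score lo hi (fst z) (snd z) \<le> u}"
  let ?f = "score_frequency lo hi m"
  have [measurable]: "(\<lambda>D. ?f D u) \<in> borel_measurable (sample m)" for u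
    by (rule measurable_score_frequency[where lo = "\<lambda>_. lo" and hi = "\<lambda>_. hi" and D = "\<lambda>D. D"])
      (use lo hi in measurable)
  have freq: "?f D u = (\<Sum>i<m. of_bool (D i \<in> ?A u)) / real m" if "D \<in> space (sample m)" for D u
  proof -
    have "D i \<in> space PXY" if "i < m" for i
      using \<open>D \<in> space (sample m)\<close> that by (auto simp: sample_law_def space_PiM)
    then show ?thesis unfolding score_frequency_def by simp
  qed
  define B1 where "B1 = {D \<in> space (sample m). ?f D s \<ge> score_cdf lo hi s + \<eta>}"
  define B2 where "B2 = {D \<in> space (sample m). ?f D t \<le> score_cdf lo hi t - \<eta>}"
  have [measurable]: "B1 \<in> S.events" "B2 \<in> S.events" unfolding B1_def B2_def by measurable
  have \<eta>: "0 \<le> \<eta>" "exp (- 2 * real m * \<eta>\<^sup>2) = \<delta> / 4"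
    unfolding \<eta>_def using exp_eta_scale[OF \<delta> m] by auto
  have "B1 = {D \<in> space (sample m). (\<Sum>i<m. of_bool (D i \<in> ?A s)) / real m \<ge> measure PXY (?A s) + \<eta>}"
    unfolding B1_def score_cdf_def by (simp only: freq cong: conj_cong)
  then have "S.prob B1 \<le> exp (- 2 * real m * \<eta>\<^sup>2)"
    using empirical_frequency_upper_tail[OF prob_space_PXY score_event[OF lo hi] m \<eta>(1), of s]
    by (simp only: sample_law_def)
  moreover have "B2 = {D \<in> space (sample m). (\<Sum>i<m. of_bool (D i \<in> ?A t)) / real m
    \<le> measure PXY (?A t) - \<eta>}"
    unfolding B2_def score_cdf_def by (simp only: freq cong: conj_cong)
  then have "S.prob B2 \<le> exp (- 2 * real m * \<eta>\<^sup>2)"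
    using empirical_frequency_lower_tail[OF prob_space_PXY score_event[OF lo hi] m \<eta>(1), of t]
    by (simp only: sample_law_def)
  ultimately have "S.prob (B1 \<union> B2) \<le> \<delta> / 2"
    using measure_Un_le[of B1 "sample m" B2] unfolding \<eta>(2) by simp
  then have "1 - \<delta> / 2 \<le> S.prob (space (sample m) - (B1 \<union> B2))"
    by (subst S.prob_compl) auto
  moreover have "1 - \<alpha> < conformal_level \<alpha> m"
    using conformal_level_bounds(1)[OF m, of \<alpha>] \<alpha> m by (smt (verit) divide_pos_pos of_nat_0_less_iff)
  then have "ereal s \<le> conformal_quantile \<alpha> lo hi m D \<and> conformal_quantile \<alpha> lo hi m D \<le> ereal t"
    if "D \<in> space (sample m) - (B1 \<union> B2)" for D
    using that below above
    by (intro conjI conformal_quantile_ge conformal_quantile_le) (auto simp: B1_def B2_def \<eta>_def)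
  ultimately show ?thesis
    by (intro bexI[of _ "space (sample m) - (B1 \<union> B2)"]) auto
qed

text \<open>
  Both ends of the prediction interval at \<open>x\<close> together miss the oracle ends by at most the two endpoint
  errors plus \<open>2 * \<rho>\<close>. The factors 1 and \<open>\<mu>up\<close> turn this into errors of length and of coverage.
\<close>

lemma cqr_error_bound:
  fixes m :: nat and D :: "nat \<Rightarrow> (real ^ 'd) \<times> real"
  assumes [measurable]: "flo \<in> borel_measurable PX" "fhi \<in> borel_measurable PX"
    and err: "L2_norm PX (\<lambda>x. ereal (flo x - qlo x)) \<le> ereal \<epsilon>"
      "L2_norm PX (\<lambda>x. ereal (fhi x - qhi x)) \<le> ereal \<epsilon>"
    and nonneg: "0 \<le> \<epsilon>" "0 \<le> \<rho>"
  defines "lo \<equiv> sort_lower flo fhi" and "hi \<equiv> sort_upper flo fhi"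
  defines "C \<equiv> cqr_set \<alpha> lo hi m D"
  assumes Q: "ereal (-\<rho>) \<le> conformal_quantile \<alpha> lo hi m D" "conformal_quantile \<alpha> lo hi m D \<le> ereal \<rho>"
  shows "max (length_error PX C (oracle_interval K \<alpha>)) (coverage_error PX K \<alpha> C)
    \<le> ereal (max 1 \<mu>up * (3 * \<epsilon> + 4 * \<rho>))"
proof -
  obtain q where q: "conformal_quantile \<alpha> lo hi m D = ereal q" and \<rho>: "\<bar>q\<bar> \<le> \<rho>"
    using Q by (cases "conformal_quantile \<alpha> lo hi m D") auto
  have C: "C x = {lo x - q..hi x + q}" for x
    unfolding C_def by (rule cqr_set_eq_Icc[OF q])
  let ?u = "\<lambda>x. flo x - qlo x" and ?v = "\<lambda>x. fhi x - qhi x"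
  have shift: "\<bar>(lo x - q) - qlo x\<bar> + \<bar>(hi x + q) - qhi x\<bar> \<le> \<bar>?u x\<bar> + \<bar>?v x\<bar> + 2 * \<rho>"
    if "x \<in> space PX" for x
  proof -
    have "\<bar>lo x - qlo x\<bar> + \<bar>hi x - qhi x\<bar> \<le> \<bar>?u x\<bar> + \<bar>?v x\<bar>"
      unfolding lo_def hi_def
      by (rule sort_error_le[where a = qlo and b = qhi, OF qlo_le_qhi[OF that]])
    moreover have "\<bar>(lo x - q) - qlo x\<bar> \<le> \<bar>lo x - qlo x\<bar> + \<rho>" "\<bar>(hi x + q) - qhi x\<bar> \<le> \<bar>hi x - qhi x\<bar> + \<rho>"
      using \<rho> by linarith+
    ultimately show ?thesis by simp
  qed
  let ?k = "max 1 \<mu>up"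
  have scale: "c * (\<bar>?u x\<bar> + \<bar>?v x\<bar> + 2 * \<rho>) \<le> ?k * (\<bar>?u x\<bar> + \<bar>?v x\<bar> + 2 * \<rho>)" if "c \<le> ?k" for x c
    using that nonneg by (intro mult_right_mono) auto
  have "length_error PX C (oracle_interval K \<alpha>) \<le> ereal (?k * (3 * \<epsilon> + 2 * (2 * \<rho>)))"
    unfolding length_error_def
  proof (rule L2_norm_perturbation[OF prob_space_axioms _ _ err])
    fix x assume x: "x \<in> space PX"
    have len: "enn2ereal (emeasure lborel {a..b}) = ereal (max 0 (b - a))" for a b :: real
      by (cases "a \<le> b") (auto simp: enn2ereal_ennreal zero_ennreal.rep_eq zero_ereal_def)
    show "enn2ereal (emeasure lborel (C x)) - enn2ereal (emeasure lborel (oracle_interval K \<alpha> x)) =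
        ereal (max 0 ((hi x + q) - (lo x - q)) - (qhi x - qlo x))"
      using qlo_le_qhi[OF x] by (simp add: C oracle_interval_def len max_def)
    have "\<bar>max 0 ((hi x + q) - (lo x - q)) - (qhi x - qlo x)\<bar> \<le> 1 * (\<bar>?u x\<bar> + \<bar>?v x\<bar> + 2 * \<rho>)"
    proof -
      have "\<bar>max 0 (b - a) - (b' - a')\<bar> \<le> \<bar>a - a'\<bar> + \<bar>b - b'\<bar>" if "a' \<le> b'" for a b a' b' :: real
        using that by linarith
      from order_trans[OF this[OF qlo_le_qhi[OF x]] shift[OF x]] show ?thesis by simp
    qed
    also have "\<dots> \<le> ?k * (\<bar>?u x\<bar> + \<bar>?v x\<bar> + 2 * \<rho>)" by (rule scale) simp
    finally show "\<bar>max 0 ((hi x + q) - (lo x - q)) - (qhi x - qlo x)\<bar> \<le> ?k * (\<bar>?u x\<bar> + \<bar>?v x\<bar> + 2 * \<rho>)" .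
  qed (use nonneg in auto)
  moreover have "coverage_error PX K \<alpha> C \<le> ereal (?k * (3 * \<epsilon> + 2 * (2 * \<rho>)))"
    unfolding coverage_error_def
  proof (rule L2_norm_perturbation[OF prob_space_axioms _ _ err])
    fix x assume x: "x \<in> space PX"
    have "\<bar>coverage K C x - (1 - \<alpha>)\<bar> \<le> \<mu>up * (\<bar>(lo x - q) - qlo x\<bar> + \<bar>(hi x + q) - qhi x\<bar>)"
      using coverage_perturb[OF x, of "lo x - q" "hi x + q" "qlo x" "qhi x"] coverage_oracle[OF x]
      by (simp add: coverage_def C)
    also have "\<dots> \<le> \<mu>up * (\<bar>?u x\<bar> + \<bar>?v x\<bar> + 2 * \<rho>)"
      using shift[OF x] pos by (intro mult_left_mono) auto
    also have "\<dots> \<le> ?k * (\<bar>?u x\<bar> + \<bar>?v x\<bar> + 2 * \<rho>)" by (rule scale) simp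
    finally show "\<bar>coverage K C x - (1 - \<alpha>)\<bar> \<le> ?k * (\<bar>?u x\<bar> + \<bar>?v x\<bar> + 2 * \<rho>)" .
  qed (use nonneg in auto)
  ultimately show ?thesis by simp
qed

text \<open>
  The window for the conformal quantile is \<open>{-r..\<rho>}\<close>, with \<open>r\<close> and \<open>\<rho>\<close> such that the gain \<open>2 * \<mu>low * r\<close>
  pays exactly for the endpoint error and the deviation \<open>\<eta>\<close>, and \<open>2 * \<mu>low * \<rho>\<close> in addition for the
  rounding of the conformal level. As \<open>r \<le> \<rho>\<close>, the quantile is at most \<open>\<rho>\<close> in absolute value.
\<close>

lemma cqr_bound_given_endpoints:
  assumes [measurable]: "flo \<in> borel_measurable PX" "fhi \<in> borel_measurable PX"
    and err: "L2_norm PX (\<lambda>x. ereal (flo x - qlo x)) \<le> ereal \<epsilon>"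
      "L2_norm PX (\<lambda>x. ereal (fhi x - qhi x)) \<le> ereal \<epsilon>"
    and \<epsilon>: "0 < \<epsilon>" and m: "0 < m" and \<delta>: "0 < \<delta>" "\<delta> < 1"
    and small: "2 * \<mu>up * \<epsilon> + eta_scale m \<delta> \<le> 2 * \<mu>low * r_minus \<alpha> \<mu>up"
      "2 * \<mu>up * \<epsilon> + eta_scale m \<delta> + s_scale \<alpha> m \<le> 2 * \<mu>low * r_plus \<alpha> \<mu>up"
  defines "lo \<equiv> sort_lower flo fhi" and "hi \<equiv> sort_upper flo fhi"
  defines "\<rho> \<equiv> (2 * \<mu>up * \<epsilon> + eta_scale m \<delta> + s_scale \<alpha> m) / (2 * \<mu>low)"
  shows "\<exists>F\<in>sets (sample m). 1 - \<delta> / 2 \<le> measure (sample m) F \<and>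
    (\<forall>D\<in>F. max (length_error PX (cqr_set \<alpha> lo hi m D) (oracle_interval K \<alpha>))
        (coverage_error PX K \<alpha> (cqr_set \<alpha> lo hi m D)) \<le> ereal (max 1 \<mu>up * (3 * \<epsilon> + 4 * \<rho>)))"
proof -
  let ?\<eta> = "eta_scale m \<delta>" and ?s = "s_scale \<alpha> m"
  define r where "r = (2 * \<mu>up * \<epsilon> + ?\<eta>) / (2 * \<mu>low)"
  have \<eta>: "0 \<le> ?\<eta>" using exp_eta_scale[OF \<delta> m] by simp
  have s: "0 \<le> ?s"
    using conformal_level_bounds(1)[OF m, of \<alpha>] \<alpha>
      by (simp add: s_scale_def) (smt (verit) divide_nonneg_nonneg of_nat_0_le_iff)
  have r: "2 * \<mu>low * r = 2 * \<mu>up * \<epsilon> + ?\<eta>" "2 * \<mu>low * \<rho> = 2 * \<mu>up * \<epsilon> + ?\<eta> + ?s"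
    using pos by (auto simp: r_def \<rho>_def)
  have nonneg: "0 \<le> r" "0 \<le> \<rho>" and "r \<le> \<rho>"
    using pos \<epsilon> \<eta> s unfolding r_def \<rho>_def
      by (auto intro!: divide_nonneg_pos divide_right_mono add_nonneg_nonneg)
  have "2 * \<mu>low * r \<le> 2 * \<mu>low * r_minus \<alpha> \<mu>up" "2 * \<mu>low * \<rho> \<le> 2 * \<mu>low * r_plus \<alpha> \<mu>up"
    using small r by auto
  then have "r \<le> r_minus \<alpha> \<mu>up" "\<rho> \<le> r_plus \<alpha> \<mu>up" using pos by simp_all
  then have le: "r \<le> (1 - \<alpha>) / (2 * \<mu>up)" "\<rho> \<le> \<alpha> / (2 * \<mu>up)"
    by (auto simp: r_minus_def r_plus_def r_zero_def)
  have [measurable]: "lo \<in> borel_measurable PX" "hi \<in> borel_measurable PX"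
    unfolding lo_def hi_def sort_lower_def sort_upper_def by measurable
  have [measurable]: "(\<lambda>x. flo x - qlo x) \<in> borel_measurable PX" "(\<lambda>x. fhi x - qhi x) \<in> borel_measurable PX"
    by measurable
  note L1 = L2_norm_imp_L1[OF prob_space_axioms _ err(1) \<epsilon>] L2_norm_imp_L1[OF prob_space_axioms _ err(2) \<epsilon>]
  note int = L2_norm_imp_integrable[OF prob_space_axioms _ err(1) \<epsilon>] L2_norm_imp_integrable[OF prob_space_axioms _ err(2) \<epsilon>]
  have sorted: "\<bar>lo x - qlo x\<bar> + \<bar>hi x - qhi x\<bar> \<le> \<bar>flo x - qlo x\<bar> + \<bar>fhi x - qhi x\<bar>" if "x \<in> space PX" for x
    unfolding lo_def hi_def by (rule sort_error_le[where a = qlo and b = qhi, OF qlo_le_qhi[OF that]])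
  have int_sorted: "integrable PX (\<lambda>x. \<bar>lo x - qlo x\<bar> + \<bar>hi x - qhi x\<bar>)"
    by (rule Bochner_Integration.integrable_bound[where f = "\<lambda>x. \<bar>flo x - qlo x\<bar> + \<bar>fhi x - qhi x\<bar>"])
      (use int sorted in \<open>auto intro!: AE_I2\<close>)
  have "(\<integral>x. \<bar>lo x - qlo x\<bar> + \<bar>hi x - qhi x\<bar> \<partial>PX) \<le> (\<integral>x. \<bar>flo x - qlo x\<bar> + \<bar>fhi x - qhi x\<bar> \<partial>PX)"
    using int sorted by (intro integral_mono int_sorted) auto
  also have "\<dots> \<le> 2 * \<epsilon>" using L1 int by simp
  finally have L1_sorted: "(\<integral>x. \<bar>lo x - qlo x\<bar> + \<bar>hi x - qhi x\<bar> \<partial>PX) \<le> 2 * \<epsilon>" .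
  have below: "score_cdf lo hi (- r) + ?\<eta> \<le> 1 - \<alpha>"
    using score_cdf_narrowed[OF _ _ int_sorted L1_sorted nonneg(1) le(1)] r by simp
  have above: "conformal_level \<alpha> m + ?\<eta> \<le> score_cdf lo hi \<rho>"
    using score_cdf_widened[OF _ _ int_sorted L1_sorted nonneg(2) le(2)] r by (simp add: s_scale_def)
  obtain F where F: "F \<in> sets (sample m)" "1 - \<delta> / 2 \<le> measure (sample m) F"
    and Q: "\<And>D. D \<in> F \<Longrightarrow> ereal (- r) \<le> conformal_quantile \<alpha> lo hi m D \<and> conformal_quantile \<alpha> lo hi m D
      \<le> ereal \<rho>"
    using calibration[OF _ _ m \<delta> below above] by auto
  show ?thesis
  proof (intro bexI[OF _ F(1)] conjI F(2) ballI)
    fix D assume "D \<in> F"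
    from Q[OF this] have "ereal (-\<rho>) \<le> conformal_quantile \<alpha> lo hi m D" "conformal_quantile \<alpha> lo hi m D
      \<le> ereal \<rho>"
      using \<open>r \<le> \<rho>\<close> by (auto intro: order_trans[of _ "ereal (-r)"])
    then show "max (length_error PX (cqr_set \<alpha> lo hi m D) (oracle_interval K \<alpha>))
        (coverage_error PX K \<alpha> (cqr_set \<alpha> lo hi m D)) \<le> ereal (max 1 \<mu>up * (3 * \<epsilon> + 4 * \<rho>))"
      unfolding lo_def hi_def using \<epsilon> nonneg by (intro cqr_error_bound err) auto
  qed
qed

text \<open>
  The two endpoint events depend on the training sample only and hold jointly with probability at least
  \<open>1 - \<delta> / 2\<close>. Given such a training sample, the calibration sample is good with probability at least
  \<open>1 - \<delta> / 2\<close> as well, and \<open>(1 - \<delta> / 2)\<^sup>2 \<ge> 1 - \<delta>\<close>.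
\<close>

lemma split_cqr_bound:
  assumes meas: "(\<lambda>z. flo (fst z) (snd z)) \<in> borel_measurable (sample n \<Otimes>\<^sub>M PX)"
      "(\<lambda>z. fhi (fst z) (snd z)) \<in> borel_measurable (sample n \<Otimes>\<^sub>M PX)"
    and endpoints:
      "\<P>(D in sample n. L2_norm PX (\<lambda>x. ereal (flo D x - qlo x)) \<le> ereal \<epsilon>) \<ge> 1 - \<delta> / 4"
      "\<P>(D in sample n. L2_norm PX (\<lambda>x. ereal (fhi D x - qhi x)) \<le> ereal \<epsilon>) \<ge> 1 - \<delta> / 4"
    and \<epsilon>: "0 < \<epsilon>" and m: "0 < m" and \<delta>: "0 < \<delta>" "\<delta> < 1"
    and small: "2 * \<mu>up * \<epsilon> + eta_scale m \<delta> \<le> 2 * \<mu>low * r_minus \<alpha> \<mu>up"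
      "2 * \<mu>up * \<epsilon> + eta_scale m \<delta> + s_scale \<alpha> m \<le> 2 * \<mu>low * r_plus \<alpha> \<mu>up"
    and B: "max 1 \<mu>up * (3 * \<epsilon> + 4 * ((2 * \<mu>up * \<epsilon> + eta_scale m \<delta> + s_scale \<alpha> m) / (2 * \<mu>low))) \<le> B"
  shows "\<P>((Dtr, Dcal) in sample n \<Otimes>\<^sub>M sample m.
      max (length_error PX (split_cqr \<alpha> flo fhi m Dtr Dcal) (oracle_interval K \<alpha>))
        (coverage_error PX K \<alpha> (split_cqr \<alpha> flo fhi m Dtr Dcal)) \<le> ereal B) \<ge> 1 - \<delta>"
proof -
  interpret tr: prob_space "sample n" by (rule prob_space_sample)
  define Elo where "Elo = {D \<in> space (sample n). L2_norm PX (\<lambda>x. ereal (flo D x - qlo x)) \<le> ereal \<epsilon>}"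
  define Ehi where "Ehi = {D \<in> space (sample n). L2_norm PX (\<lambda>x. ereal (fhi D x - qhi x)) \<le> ereal \<epsilon>}"
  have prob: "1 - \<delta> / 4 \<le> tr.prob Elo" "1 - \<delta> / 4 \<le> tr.prob Ehi"
    using endpoints by (auto simp: Elo_def Ehi_def)
  \<comment> \<open>Events of positive probability are measurable, because \<open>measure\<close> vanishes outside the \<open>\<sigma>\<close>-algebra.\<close>
  have [measurable]: "Elo \<in> tr.events" "Ehi \<in> tr.events"
    using prob \<delta> measure_notin_sets[of Elo "sample n"] measure_notin_sets[of Ehi "sample n"] by force+
  define E where "E = Elo \<inter> Ehi"
  have E: "E \<in> tr.events" unfolding E_def by measurable
  have "1 - \<delta> / 2 \<le> tr.prob E"
  proof -
    have "tr.prob Elo + tr.prob Ehi = tr.prob (Elo \<union> Ehi) + tr.prob E"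
      using tr.finite_measure_Union'[of Elo Ehi] tr.finite_measure_Diff'[of Ehi Elo]
      by (simp add: E_def Int_commute)
    then show ?thesis using prob tr.prob_le_1[of "Elo \<union> Ehi"] by linarith
  qed
  let ?lo = "\<lambda>w. sort_lower (flo (fst w)) (fhi (fst w))" and ?hi
    = "\<lambda>w. sort_upper (flo (fst w)) (fhi (fst w))"
  define G where "G = {w \<in> space (sample n \<Otimes>\<^sub>M sample m).
     max (length_error PX (cqr_set \<alpha> (?lo w) (?hi w) m (snd w)) (oracle_interval K \<alpha>))
        (coverage_error PX K \<alpha> (cqr_set \<alpha> (?lo w) (?hi w) m (snd w))) \<le> ereal B}"
  let ?N = "sample n \<Otimes>\<^sub>M sample m"
  have [measurable]: "(\<lambda>z. flo (fst (fst z)) (snd z)) \<in> borel_measurable (?N \<Otimes>\<^sub>M PX)"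
      "(\<lambda>z. fhi (fst (fst z)) (snd z)) \<in> borel_measurable (?N \<Otimes>\<^sub>M PX)"
    using measurable_compose[OF _ meas(1), of "\<lambda>z. (fst (fst z), snd z)" "?N \<Otimes>\<^sub>M PX"]
      measurable_compose[OF _ meas(2), of "\<lambda>z. (fst (fst z), snd z)" "?N \<Otimes>\<^sub>M PX"] by simp_all
  have "(\<lambda>z. ?lo (fst z) (snd z)) \<in> borel_measurable (?N \<Otimes>\<^sub>M PX)"
      "(\<lambda>z. ?hi (fst z) (snd z)) \<in> borel_measurable (?N \<Otimes>\<^sub>M PX)"
    unfolding sort_lower_def sort_upper_def by measurable
  note [measurable] = measurable_errors[OF this measurable_snd]
  have G: "G \<in> sets ?N" unfolding G_def by measurable
  have "(1 - \<delta> / 2) * (1 - \<delta> / 2) \<le> measure ?N G"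
  proof (rule prob_pair_lower_bound[OF prob_space_sample prob_space_sample G E \<open>1 - \<delta> / 2 \<le> tr.prob E\<close>])
    fix D assume D: "D \<in> E"
    then have space: "D \<in> space (sample n)" by (simp add: E_def Elo_def)
    have f: "flo D \<in> borel_measurable PX" "fhi D \<in> borel_measurable PX"
      using measurable_compose[OF measurable_Pair1'[OF space] meas(1)] measurable_compose[OF measurable_Pair1'[OF space] meas(2)]
      by simp_all
    have "L2_norm PX (\<lambda>x. ereal (flo D x - qlo x)) \<le> ereal \<epsilon>" "L2_norm PX (\<lambda>x. ereal (fhi D x - qhi x))
      \<le> ereal \<epsilon>"
      using D by (auto simp: E_def Elo_def Ehi_def)
    from cqr_bound_given_endpoints[OF f this \<epsilon> m \<delta> small]
    obtain F where F: "F \<in> sets (sample m)" "1 - \<delta> / 2 \<le> measure (sample m) F"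
      and bound: "\<And>D'. D' \<in> F \<Longrightarrow> max (length_error PX (cqr_set \<alpha> (?lo (D, D')) (?hi (D, D')) m D') (oracle_interval K \<alpha>))
        (coverage_error PX K \<alpha> (cqr_set \<alpha> (?lo (D, D')) (?hi (D, D')) m D'))
        \<le> ereal (max 1 \<mu>up * (3 * \<epsilon> + 4 * ((2 * \<mu>up * \<epsilon> + eta_scale m \<delta> + s_scale \<alpha> m) / (2 * \<mu>low))))"
      by (simp only: fst_conv) blast
    have "{D} \<times> F \<subseteq> G"
    proof clarify
      fix D' assume D': "D' \<in> F"
      note order_trans[OF bound[OF this], of "ereal B"]
      then show "(D, D') \<in> G"
        using B space D' sets.sets_into_space[OF F(1)] unfolding G_def
        by (auto simp: space_pair_measure)
    qed
    with F show "\<exists>F\<in>sets (sample m). 1 - \<delta> / 2 \<le> measure (sample m) F \<and> {D} \<times> F \<subseteq> G" by blast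
  qed (use \<delta> in auto)
  moreover have "1 - \<delta> \<le> (1 - \<delta> / 2) * (1 - \<delta> / 2)" by (simp add: algebra_simps)
  ultimately have "1 - \<delta> \<le> measure ?N G" by linarith
  then show ?thesis
    by (simp add: G_def split_cqr_def case_prod_beta')
qed

end

section \<open>The rate\<close>

theorem corollary11:
  fixes \<alpha> \<mu>low \<mu>up \<beta> M L\<beta> Crate Cconf :: real
  assumes \<alpha>: "0 < \<alpha>" "\<alpha> < 1"
    and constants_pos: "0 < Crate" "0 < Cconf"
    and endpoint_bound:
      "\<And>(PX :: (real ^ 'd) measure) K n u \<tau> f.
         \<lbrakk>regression_model PX K; bounded_response K M; bounded_density K M \<mu>low \<mu>up;
          smooth_quantiles K \<alpha> \<beta> L\<beta>; \<tau> \<in> {\<alpha> / 2, 1 - \<alpha> / 2}; 0 < u; u < 1;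
          n_SH CARD('d) \<beta> L\<beta> \<le> n; measurable_erm PX K \<beta> M n \<tau> f\<rbrakk>
         \<Longrightarrow> \<P>(D in sample_law PX K n.
                L2_norm PX (\<lambda>x. ereal (f D x - cond_quantile K \<tau> x))
                \<le> ereal (endpoint_rate CARD('d) \<beta> Crate Cconf n u)) \<ge> 1 - u"
  shows "\<exists>C. \<forall>(PX :: (real ^ 'd) measure) K \<delta> n m flo fhi.
           regression_model PX K \<and> bounded_response K M \<and> bounded_density K M \<mu>low \<mu>up \<and>
           smooth_quantiles K \<alpha> \<beta> L\<beta> \<and>
           0 < \<delta> \<and> \<delta> < 1 \<and> n_SH CARD('d) \<beta> L\<beta> \<le> n \<and> 1 \<le> m \<and>
           measurable_erm PX K \<beta> M n (\<alpha> / 2) flo \<and>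
           measurable_erm PX K \<beta> M n (1 - \<alpha> / 2) fhi \<and>
           2 * \<mu>up * endpoint_radius CARD('d) \<beta> M L\<beta> Crate Cconf n (\<delta> / 4) + eta_scale m \<delta>
             \<le> 2 * \<mu>low * r_minus \<alpha> \<mu>up \<and>
           2 * \<mu>up * endpoint_radius CARD('d) \<beta> M L\<beta> Crate Cconf n (\<delta> / 4) + eta_scale m \<delta>
             + s_scale \<alpha> m \<le> 2 * \<mu>low * r_plus \<alpha> \<mu>up
           \<longrightarrow>
           \<P>((Dtr, Dcal) in sample_law PX K n \<Otimes>\<^sub>M sample_law PX K m.
              max (length_error PX (split_cqr \<alpha> flo fhi m Dtr Dcal) (oracle_interval K \<alpha>))
                  (coverage_error PX K \<alpha> (split_cqr \<alpha> flo fhi m Dtr Dcal))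
              \<le> ereal (C * (real n powr (- \<beta> / (2 * \<beta> + real CARD('d))) * ln (real n) powr (3 / 2)
                            + sqrt (ln (4 / \<delta>) / real n)
                            + 1 / real m
                            + sqrt (ln (4 / \<delta>) / real m)))) \<ge> 1 - \<delta>"
proof -
  \<comment> \<open>With \<open>R\<close> the bracket of the claim: \<open>\<epsilon> \<le> A * R\<close>, and \<open>\<eta> + s \<le> 2 * R\<close> because
    \<open>s \<le> 2 / m\<close>.\<close>
  define A where "A = max Crate Cconf"
  define C where "C = max 1 \<mu>up * (3 * A + 4 * ((2 * \<mu>up * A + 2) / (2 * \<mu>low)))"
  show ?thesis
  proof (intro exI[of _ C] allI impI, elim conjE)
    fix PX :: "(real ^ 'd) measure" and K \<delta> n m flo fhi
    assume model: "regression_model PX K" "bounded_response K M" "bounded_density K M \<mu>low \<mu>up"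
      and smooth: "smooth_quantiles K \<alpha> \<beta> L\<beta>"
      and \<delta>: "0 < \<delta>" "\<delta> < 1" and n: "n_SH CARD('d) \<beta> L\<beta> \<le> n" and m: "1 \<le> m"
      and erm: "measurable_erm PX K \<beta> M n (\<alpha> / 2) flo" "measurable_erm PX K \<beta> M n (1 - \<alpha> / 2) fhi"
      and small: "2 * \<mu>up * endpoint_radius CARD('d) \<beta> M L\<beta> Crate Cconf n (\<delta> / 4) + eta_scale m \<delta>
             \<le> 2 * \<mu>low * r_minus \<alpha> \<mu>up"
        "2 * \<mu>up * endpoint_radius CARD('d) \<beta> M L\<beta> Crate Cconf n (\<delta> / 4) + eta_scale m \<delta>
             + s_scale \<alpha> m \<le> 2 * \<mu>low * r_plus \<alpha> \<mu>up"
    interpret prob_space PX using model(1) by (simp add: regression_model_def)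
    interpret quantile_regression_model PX K M \<mu>low \<mu>up \<alpha>
      using model \<alpha> by unfold_locales auto
    let ?a = "real n powr (- \<beta> / (2 * \<beta> + real CARD('d))) * ln (real n) powr (3 / 2)"
    let ?b = "sqrt (ln (4 / \<delta>) / real n)" and ?c = "1 / real m" and ?d = "sqrt (ln (4 / \<delta>) / real m)"
    define R where "R = ?a + ?b + ?c + ?d"
    define \<epsilon> where "\<epsilon> = endpoint_rate CARD('d) \<beta> Crate Cconf n (\<delta> / 4)"
    have ln_pos: "0 < ln (4 / \<delta>)" using \<delta> by simp
    have terms: "0 \<le> ?a" "0 \<le> ?b" "0 \<le> ?c" "0 \<le> ?d" using ln_pos by auto
    have n_pos: "0 < n"
    proof -
      have "0 < exp (3 * (2 * \<beta> + real CARD('d)) / (2 * \<beta>))" by simp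
      then have "0 < n_SH CARD('d) \<beta> L\<beta>" unfolding n_SH_def by (simp add: less_max_iff_disj)
      with n show ?thesis by simp
    qed
    have \<epsilon>: "\<epsilon> = Crate * ?a + Cconf * ?b"
      by (simp add: \<epsilon>_def endpoint_rate_def)
    have "0 < ?b" using ln_pos n_pos by simp
    then have \<epsilon>_pos: "0 < \<epsilon>" unfolding \<epsilon> using constants_pos terms by (simp add: add_nonneg_pos)
    have "\<epsilon> \<le> A * ?a + A * ?b"
      unfolding \<epsilon> A_def using terms by (intro add_mono mult_right_mono) auto
    also have "\<dots> \<le> A * R"
      unfolding R_def distrib_left[symmetric] using terms constants_pos
        by (intro mult_left_mono) (auto simp: A_def)
    finally have \<epsilon>_le: "\<epsilon> \<le> A * R" .
    have "eta_scale m \<delta> \<le> ?d"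
      unfolding eta_scale_def using ln_pos m by (intro real_sqrt_le_mono divide_left_mono) auto
    then have \<eta>_le: "eta_scale m \<delta> \<le> ?d" .
    have "s_scale \<alpha> m \<le> (2 - \<alpha>) / real m"
      using conformal_level_bounds(2)[of m \<alpha>] m by (simp add: s_scale_def)
    also have "\<dots> \<le> 2 / real m" using \<alpha> by (intro divide_right_mono) auto
    finally have s_le: "s_scale \<alpha> m \<le> 2 * ?c" by simp
    have slack_le: "eta_scale m \<delta> + s_scale \<alpha> m \<le> 2 * R"
    proof -
      have "x + y \<le> 2 * (a + b + c + d)"
        if "x \<le> d" "y \<le> 2 * c" "0 \<le> a" "0 \<le> b" "0 \<le> d" for x y a b c d :: real
        using that by simp
      from this[OF \<eta>_le s_le terms(1,2,4)] show ?thesis unfolding R_def .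
    qed
    have eta_nonneg: "0 \<le> eta_scale m \<delta>" using exp_eta_scale[OF \<delta>] m by simp
    \<comment> \<open>A radius of \<open>2 * M\<close> would violate the smallness condition: a density on \<open>{-M..M}\<close>
      has \<open>1 \<le> 2 * M * \<mu>up\<close>, whereas \<open>2 * \<mu>low * r_minus \<alpha> \<mu>up \<le> \<alpha> < 1\<close>.\<close>
    have radius: "endpoint_radius CARD('d) \<beta> M L\<beta> Crate Cconf n (\<delta> / 4) = \<epsilon>"
    proof (rule ccontr)
      assume "endpoint_radius CARD('d) \<beta> M L\<beta> Crate Cconf n (\<delta> / 4) \<noteq> \<epsilon>"
      then have eq: "endpoint_radius CARD('d) \<beta> M L\<beta> Crate Cconf n (\<delta> / 4) = 2 * M"
        using n by (simp add: endpoint_radius_def \<epsilon>_def min_def split: if_splits)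
      have "2 * \<mu>up * (2 * M) \<le> 2 * \<mu>low * r_minus \<alpha> \<mu>up"
        using small(1)[unfolded eq] eta_nonneg by linarith
      also have "\<dots> \<le> 2 * \<mu>up * (\<alpha> / (2 * \<mu>up))"
        using pos \<alpha> by (intro mult_mono) (auto simp: r_minus_def r_zero_def)
      also have "\<dots> < 1" using pos \<alpha> by simp
      finally show False using pos(4) by (simp add: mult.commute)
    qed
    have prob: "\<P>(D in sample n. L2_norm PX (\<lambda>x. ereal (flo D x - qlo x)) \<le> ereal \<epsilon>) \<ge> 1 - \<delta> / 4"
      "\<P>(D in sample n. L2_norm PX (\<lambda>x. ereal (fhi D x - qhi x)) \<le> ereal \<epsilon>) \<ge> 1 - \<delta> / 4"
      unfolding \<epsilon>_def using \<delta> by (auto intro!: endpoint_bound[OF model smooth] n erm)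
    have "max 1 \<mu>up * (3 * \<epsilon> + 4 * ((2 * \<mu>up * \<epsilon> + eta_scale m \<delta> + s_scale \<alpha> m) / (2 * \<mu>low)))
      \<le> max 1 \<mu>up * (3 * (A * R) + 4 * ((2 * \<mu>up * (A * R) + 2 * R) / (2 * \<mu>low)))"
    proof -
      have "2 * \<mu>up * \<epsilon> \<le> 2 * \<mu>up * (A * R)" using \<epsilon>_le pos by simp
      with slack_le have "2 * \<mu>up * \<epsilon> + eta_scale m \<delta> + s_scale \<alpha> m \<le> 2 * \<mu>up * (A * R) + 2 * R" by linarith
      then have "(2 * \<mu>up * \<epsilon> + eta_scale m \<delta> + s_scale \<alpha> m) / (2 * \<mu>low)
          \<le> (2 * \<mu>up * (A * R) + 2 * R) / (2 * \<mu>low)"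
        using pos by (intro divide_right_mono) auto
      with \<epsilon>_le show ?thesis by (intro mult_left_mono add_mono) simp_all
    qed
    also have "\<dots> = C * R" unfolding C_def using pos by (simp add: field_simps)
    finally have bound: "max 1 \<mu>up * (3 * \<epsilon> + 4 * ((2 * \<mu>up * \<epsilon> + eta_scale m \<delta> + s_scale \<alpha> m) / (2 * \<mu>low)))
      \<le> C * R" .
    have meas: "(\<lambda>z. flo (fst z) (snd z)) \<in> borel_measurable (sample n \<Otimes>\<^sub>M PX)"
      "(\<lambda>z. fhi (fst z) (snd z)) \<in> borel_measurable (sample n \<Otimes>\<^sub>M PX)"
      using erm by (auto simp: measurable_erm_def case_prod_beta')
    have "0 < m" using m by simp
    from split_cqr_bound[OF meas prob \<epsilon>_pos this \<delta> small[unfolded radius] bound]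
    show "\<P>((Dtr, Dcal) in sample n \<Otimes>\<^sub>M sample m.
              max (length_error PX (split_cqr \<alpha> flo fhi m Dtr Dcal) (oracle_interval K \<alpha>))
                  (coverage_error PX K \<alpha> (split_cqr \<alpha> flo fhi m Dtr Dcal))
              \<le> ereal (C * (?a + ?b + ?c + ?d))) \<ge> 1 - \<delta>"
      unfolding R_def .
  qed
qed

end
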